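(* Let $(G,c)$ be a network with reference vertex $o$, and let $J$ be the closure of the inclusion operator $\operatorname{span}\{\delta_x\}_{x\in G}\subseteq\ell^2(G)\to\mathcal H_{\mathcal E}$, $\delta_x\mapsto\delta_x$. Then: (i) $J^\star J=\Delta_{\ell^2}$, the self-adjoint Laplace operator on $\ell^2(G)$; and (ii) $JJ^\star=\Delta_{\mathcal H_{\mathcal E}}^{(Kr)}$, the Krein extension of the Laplace operator $\Delta_{\mathcal H_{\mathcal E}}$ on $\mathcal H_{\mathcal E}$.
   Context: A network $(G,c)$ is a connected weighted undirected graph with vertex set $G$, given by a symmetric conductance function $c:G\times G\to[0,\infty)$, $(x,y)\mapsto c_{xy}=c_{yx}$, with $c_{xx}=0$; write $x\sim y$ iff $c_{xy}>0$. It is locally finite (each $x$ has only finitely many $y$ with $y\sim x$) and connected (any two vertices are joined by a finite path of edges with positive conductance). A reference vertex $o\in G$ is fixed. The Laplacian acts on functions by $(\Delta u)(x)=\sum_{y\sim x}c_{xy}(u(x)-u(y))$; this is also well defined on functions modulo constants. The energy form is $\mathcal E(u,v)=\frac12\sum_{x,y\in G}c_{xy}(u(x)-u(y))(v(x)-v(y))$ on $\operatorname{dom}\mathcal E=\{u:G\to\mathbb R:\mathcal E(u,u)<\infty\}$. The energy space $\mathcal H_{\mathcal E}:=\operatorname{dom}\mathcal E/\mathbb R\mathbf 1$ (functions of finite energy modulo constants) is a Hilbert space with inner product $\langle u,v\rangle_{\mathcal H_{\mathcal E}}=\mathcal E(u,v)$ (in the complex-valued case, $\mathcal E(\bar u,v)$).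 For $x\in G$, $v_x\in\mathcal H_{\mathcal E}$ is the unique element with $\langle v_x,u\rangle_{\mathcal H_{\mathcal E}}=u(x)-u(o)$ for all $u\in\mathcal H_{\mathcal E}$. A monopole is a $w\in\mathcal H_{\mathcal E}$ with $\Delta w=\delta_x$ pointwise for some vertex $x$. Let $w_o$ be the unique energy-minimizing monopole at $o$, and $w_x:=w_o+v_x$ for $x\ne o$. The operator $\Delta_{\mathcal H_{\mathcal E}}$ is the closed operator on $\mathcal H_{\mathcal E}$ obtained as the graph closure of $\Delta$ defined pointwise on $\operatorname{span}\{w_x\}_{x\in G}$ (finite linear combinations), where $\Delta u$ is regarded as an element of $\mathcal H_{\mathcal E}$. $\ell^2(G)$ is the space of square-summable functions on $G$ (counting measure), with $\langle u,v\rangle_{\ell^2}=\sum_{x\in G} u(x)v(x)$ (conjugate on $u$ in the complex case). $\delta_x$ denotes both the characteristic function of $\{x\}$ in $\ell^2(G)$ and the element of $\mathcal H_{\mathcal E}$ it represents (it has finite energy). $\Delta_{\ell^2}$ is the graph closure in $\ell^2(G)$ of $\Delta$ on $\operatorname{span}\{\delta_x\}_{x\in G}$ (finite linear combinations); it is self-adjoint. The inclusion operator is densely defined and closable. The superscript $\star$ denotes the Hilbert space adjoint. Krein extension: let $S$ be a semibounded operator which is not self-adjoint, and suppose that $S^\star$ has a nontrivial kernel. Let $T$ be a self-adjoint extension of $S$ which is defined on $\ker S^\star$. If $\ker S^\star\subseteq\ker T$, then $T$ is called the Krein extension of $S$, denoted $S^{(Kr)}$. *)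

theory Defs
  imports "HOL-Analysis.Analysis" "HOL-Library.Function_Algebras"
begin

section \<open>Real vector spaces of functions\<close>

instantiation "fun" :: (type, real_vector) real_vector
begin

definition scaleR_fun :: "real \<Rightarrow> ('a \<Rightarrow> 'b) \<Rightarrow> 'a \<Rightarrow> 'b"
  where "scaleR_fun r f = (\<lambda>x. r *\<^sub>R f x)"

instance
  by standard (auto simp: scaleR_fun_def fun_eq_iff algebra_simps)

end

text \<open>The space of all functions modulo constants; it does not depend on the network.\<close>

quotient_type 'v modconst = "'v \<Rightarrow> real" / "\<lambda>u v. \<exists>k. \<forall>x. u x = v x + k"
  morphisms rep_modconst cls
proof (rule equivpI)
  show "reflp (\<lambda>u v :: 'v \<Rightarrow> real. \<exists>k. \<forall>x. u x = v x + k)"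
    by (rule reflpI) (rule exI[of _ 0], simp)
  show "symp (\<lambda>u v :: 'v \<Rightarrow> real. \<exists>k. \<forall>x. u x = v x + k)"
    by (rule sympI) (metis add_diff_cancel_right' diff_conv_add_uminus)
  show "transp (\<lambda>u v :: 'v \<Rightarrow> real. \<exists>k. \<forall>x. u x = v x + k)"
    by (rule transpI) (metis add.assoc)
qed

instantiation modconst :: (type) real_vector
begin

lift_definition zero_modconst :: "'a modconst" is "0 :: 'a \<Rightarrow> real" .

lift_definition plus_modconst :: "'a modconst \<Rightarrow> 'a modconst \<Rightarrow> 'a modconst"
  is "\<lambda>u v. u + v"
proof -
  fix u u' v v' :: "'a \<Rightarrow> real"
  assume "\<exists>k. \<forall>x. u x = u' x + k" "\<exists>k. \<forall>x. v x = v' x + k"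
  then obtain k l where "\<forall>x. u x = u' x + k" "\<forall>x. v x = v' x + l" by blast
  then show "\<exists>k. \<forall>x. (u + v) x = (u' + v') x + k"
    by (intro exI[of _ "k + l"]) simp
qed

lift_definition minus_modconst :: "'a modconst \<Rightarrow> 'a modconst \<Rightarrow> 'a modconst"
  is "\<lambda>u v. u - v"
proof -
  fix u u' v v' :: "'a \<Rightarrow> real"
  assume "\<exists>k. \<forall>x. u x = u' x + k" "\<exists>k. \<forall>x. v x = v' x + k"
  then obtain k l where "\<forall>x. u x = u' x + k" "\<forall>x. v x = v' x + l" by blast
  then show "\<exists>k. \<forall>x. (u - v) x = (u' - v') x + k"
    by (intro exI[of _ "k - l"]) simp
qed

lift_definition uminus_modconst :: "'a modconst \<Rightarrow> 'a modconst" is "\<lambda>u. - u"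
proof -
  fix u u' :: "'a \<Rightarrow> real"
  assume "\<exists>k. \<forall>x. u x = u' x + k"
  then obtain k where "\<forall>x. u x = u' x + k" by blast
  then show "\<exists>k. \<forall>x. (- u) x = (- u') x + k"
    by (intro exI[of _ "- k"]) simp
qed

lift_definition scaleR_modconst :: "real \<Rightarrow> 'a modconst \<Rightarrow> 'a modconst"
  is "\<lambda>r u. r *\<^sub>R u"
proof -
  fix r and u u' :: "'a \<Rightarrow> real"
  assume "\<exists>k. \<forall>x. u x = u' x + k"
  then obtain k where "\<forall>x. u x = u' x + k" by blast
  then show "\<exists>k. \<forall>x. (r *\<^sub>R u) x = (r *\<^sub>R u') x + k"
    by (intro exI[of _ "r * k"]) (simp add: scaleR_fun_def algebra_simps)
qed

instance
  by standard
    (transfer, rule exI[of _ 0], simp add: scaleR_fun_def fun_eq_iff algebra_simps)+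

end

section \<open>Unbounded operators between real Hilbert spaces\<close>

text \<open>
  The energy space depends on the conductances, so Hilbert spaces are given by a carrier inside a
  real vector space together with an inner product.  Operators are identified with their graphs;
  the domain of A is \<open>Domain A\<close>, extension of operators is inclusion of graphs,
  and the composition "first A, then B" is \<open>A O B\<close>.
\<close>

record 'h hspace =
  pts :: "'h set"
  ip :: "'h \<Rightarrow> 'h \<Rightarrow> real"

definition hnorm :: "'h hspace \<Rightarrow> 'h \<Rightarrow> real"
  where "hnorm H x = sqrt (ip H x x)"

definition graph_closure ::
    "'h::real_vector hspace \<Rightarrow> 'k::real_vector hspace \<Rightarrow> ('h \<times> 'k) set \<Rightarrow> ('h \<times> 'k) set"
  where "graph_closure H K A =
    {(x, y). x \<in> pts H \<and> y \<in> pts K \<and>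
       (\<forall>e>0. \<exists>(a, b)\<in>A. hnorm H (x - a) < e \<and> hnorm K (y - b) < e)}"

definition densely_defined :: "'h::real_vector hspace \<Rightarrow> ('h \<times> 'k) set \<Rightarrow> bool"
  where "densely_defined H A \<longleftrightarrow>
    Domain A \<subseteq> pts H \<and> (\<forall>x\<in>pts H. \<forall>e>0. \<exists>a\<in>Domain A. hnorm H (x - a) < e)"

text \<open>For densely defined A this is the graph of the Hilbert space adjoint:
  (k, h) belongs to it iff <A x, k> = <x, h> for all x in the domain of A.\<close>

definition hadj :: "'h hspace \<Rightarrow> 'k hspace \<Rightarrow> ('h \<times> 'k) set \<Rightarrow> ('k \<times> 'h) set"
  where "hadj H K A =
    {(k, h). k \<in> pts K \<and> h \<in> pts H \<and> (\<forall>(x, y)\<in>A. ip K y k = ip H x h)}"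

definition self_adjoint :: "'h::real_vector hspace \<Rightarrow> ('h \<times> 'h) set \<Rightarrow> bool"
  where "self_adjoint H A \<longleftrightarrow> densely_defined H A \<and> hadj H H A = A"

definition op_kernel :: "('h \<times> 'k::zero) set \<Rightarrow> 'h set"
  where "op_kernel A = {x. (x, 0) \<in> A}"

text \<open>Over the reals, symmetry has to be required separately from boundedness below.\<close>

definition semibounded :: "'h::real_vector hspace \<Rightarrow> ('h \<times> 'h) set \<Rightarrow> bool"
  where "semibounded H S \<longleftrightarrow>
    densely_defined H S \<and>
    (\<forall>(x, y)\<in>S. \<forall>(x', y')\<in>S. ip H y x' = ip H x y') \<and>
    (\<exists>m. \<forall>(x, y)\<in>S. m * ip H x x \<le> ip H x y)"

text \<open>
  T is the Krein extension of S.  The notion is normally used when S is not self-adjoint and its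
  adjoint has nontrivial kernel; the conditions on T are the same without this proviso, which is
  therefore not built in.
\<close>

definition krein_extension ::
    "'h::real_vector hspace \<Rightarrow> ('h \<times> 'h) set \<Rightarrow> ('h \<times> 'h) set \<Rightarrow> bool"
  where "krein_extension H S T \<longleftrightarrow>
    semibounded H S \<and> self_adjoint H T \<and> S \<subseteq> T \<and>
    op_kernel (hadj H H S) \<subseteq> Domain T \<and>
    op_kernel (hadj H H S) \<subseteq> op_kernel T"

section \<open>Networks\<close>

text \<open>The vertex set is the type \<open>'v\<close>.\<close>

locale network =
  fixes c :: "'v \<Rightarrow> 'v \<Rightarrow> real"
  assumes nonneg: "c x y \<ge> 0"
    and sym: "c x y = c y x"
    and no_loops: "c x x = 0"
    and locally_finite: "finite {y. c x y > 0}"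
    and connected: "(x, y) \<in> {(a, b). c a b > 0}\<^sup>*"

definition delta :: "'v \<Rightarrow> 'v \<Rightarrow> real"
  where "delta x = indicator {x}"

definition laplacian :: "('v \<Rightarrow> 'v \<Rightarrow> real) \<Rightarrow> ('v \<Rightarrow> real) \<Rightarrow> 'v \<Rightarrow> real"
  where "laplacian c u x = (\<Sum>y | c x y > 0. c x y * (u x - u y))"

definition energy :: "('v \<Rightarrow> 'v \<Rightarrow> real) \<Rightarrow> ('v \<Rightarrow> real) \<Rightarrow> ('v \<Rightarrow> real) \<Rightarrow> real"
  where "energy c u v = 1/2 * (\<Sum>\<^sub>\<infinity>(x, y)\<in>UNIV. c x y * (u x - u y) * (v x - v y))"

definition finite_energy :: "('v \<Rightarrow> 'v \<Rightarrow> real) \<Rightarrow> ('v \<Rightarrow> real) \<Rightarrow> bool"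
  where "finite_energy c u \<longleftrightarrow> (\<lambda>(x, y). c x y * (u x - u y) * (u x - u y)) summable_on UNIV"

lemma modconst_diff:
  fixes u v :: "'v \<Rightarrow> real"
  assumes "\<exists>k. \<forall>x. u x = v x + k"
  shows "u x - u y = v x - v y"
  using assms by auto

lift_definition laplacian_q :: "('v \<Rightarrow> 'v \<Rightarrow> real) \<Rightarrow> 'v modconst \<Rightarrow> 'v \<Rightarrow> real" is laplacian
  unfolding laplacian_def by (auto simp: fun_eq_iff)

lift_definition energy_q :: "('v \<Rightarrow> 'v \<Rightarrow> real) \<Rightarrow> 'v modconst \<Rightarrow> 'v modconst \<Rightarrow> real" is energy
  unfolding energy_def by (simp add: modconst_diff)

lift_definition finite_energy_q :: "('v \<Rightarrow> 'v \<Rightarrow> real) \<Rightarrow> 'v modconst \<Rightarrow> bool" is finite_energy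
  unfolding finite_energy_def by (simp add: modconst_diff)

lift_definition diff_q :: "'v modconst \<Rightarrow> 'v \<Rightarrow> 'v \<Rightarrow> real" is "\<lambda>u x y. u x - u y"
  by (auto simp: fun_eq_iff)

definition HE :: "('v \<Rightarrow> 'v \<Rightarrow> real) \<Rightarrow> 'v modconst hspace"
  where "HE c = \<lparr> pts = {u. finite_energy_q c u}, ip = energy_q c \<rparr>"

definition L2 :: "('v \<Rightarrow> real) hspace"
  where "L2 = \<lparr> pts = {f. (\<lambda>x. (f x)\<^sup>2) summable_on UNIV},
                ip = (\<lambda>f g. \<Sum>\<^sub>\<infinity>x\<in>UNIV. f x * g x) \<rparr>"

definition dipole :: "('v \<Rightarrow> 'v \<Rightarrow> real) \<Rightarrow> 'v \<Rightarrow> 'v \<Rightarrow> 'v modconst"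
  where "dipole c r x =
    (THE v. v \<in> pts (HE c) \<and> (\<forall>u\<in>pts (HE c). ip (HE c) v u = diff_q u x r))"

definition monopole :: "('v \<Rightarrow> 'v \<Rightarrow> real) \<Rightarrow> 'v \<Rightarrow> 'v modconst \<Rightarrow> bool"
  where "monopole c x w \<longleftrightarrow> w \<in> pts (HE c) \<and> laplacian_q c w = delta x"

text \<open>Meaningful only when a monopole at r exists, i.e. for transient networks; this also
  applies to \<open>wfun\<close> and \<open>Lap_HE\<close> below.\<close>

definition min_monopole :: "('v \<Rightarrow> 'v \<Rightarrow> real) \<Rightarrow> 'v \<Rightarrow> 'v modconst"
  where "min_monopole c r =
    (THE w. monopole c r w \<and>
       (\<forall>w'. monopole c r w' \<longrightarrow> ip (HE c) w w \<le> ip (HE c) w' w'))"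

definition wfun :: "('v \<Rightarrow> 'v \<Rightarrow> real) \<Rightarrow> 'v \<Rightarrow> 'v \<Rightarrow> 'v modconst"
  where "wfun c r x = (if x = r then min_monopole c r else min_monopole c r + dipole c r x)"

definition Lap_HE :: "('v \<Rightarrow> 'v \<Rightarrow> real) \<Rightarrow> 'v \<Rightarrow> ('v modconst \<times> 'v modconst) set"
  where "Lap_HE c r =
    graph_closure (HE c) (HE c) {(u, cls (laplacian_q c u)) | u. u \<in> span (range (wfun c r))}"

definition Lap_L2 :: "('v \<Rightarrow> 'v \<Rightarrow> real) \<Rightarrow> (('v \<Rightarrow> real) \<times> ('v \<Rightarrow> real)) set"
  where "Lap_L2 c = graph_closure L2 L2 {(f, laplacian c f) | f. f \<in> span (range delta)}"

definition J_op :: "('v \<Rightarrow> 'v \<Rightarrow> real) \<Rightarrow> (('v \<Rightarrow> real) \<times> 'v modconst) set"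
  where "J_op c = graph_closure L2 (HE c) {(f, cls f) | f. f \<in> span (range delta)}"

abbreviation J_adj :: "('v \<Rightarrow> 'v \<Rightarrow> real) \<Rightarrow> ('v modconst \<times> ('v \<Rightarrow> real)) set"
  where "J_adj c \<equiv> hadj L2 (HE c) (J_op c)"

end

theory Submission
  imports Defs
begin

text \<open>
  Let \<open>J\<close> be the closed inclusion.  Both identities rest on the fact that
  \<open>\<langle>\<delta>\<^sub>x, u\<rangle> = (\<Delta> u)(x)\<close> in the energy space (\<open>ip_HE_delta\<close>), which says that
  \<open>J\<^sup>*\<close> is the pointwise Laplacian on those \<open>u\<close> of finite energy for which
  \<open>\<Delta> u\<close> is square-summable (\<open>J_adj_iff\<close>), and on von Neumann's argument: projecting onto the
  closed graph of \<open>J\<close> in the product of the two spaces shows that \<open>1 + J\<^sup>* J\<close> and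
  \<open>1 + J J\<^sup>*\<close> are surjective (\<open>graph_decomposition\<close>), and a densely defined
  symmetric operator \<open>T\<close> with \<open>1 + T\<close> surjective is self-adjoint
  (\<open>symmetric_surjective_self_adjoint\<close>).

  For the first identity, \<open>J\<^sup>* J\<close> and \<open>\<Delta>\<close> on \<open>\<ell>\<^sup>2\<close> are both restrictions of the
  pointwise Laplacian.  The maximum principle shows that the only square-summable solution of
  \<open>\<Delta> f = - f\<close> is 0 (\<open>laplacian_eq_minus_self\<close>): a nonzero square-summable function attains the
  maximum of its absolute value.  By duality \<open>1 + \<Delta>\<close> maps the finitely supported functions onto
  a dense subspace (\<open>resolvent_range_dense\<close>).  If \<open>\<Delta> f = h\<close> with \<open>(f, h)\<close> in \<open>J\<^sup>* J\<close>, take a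
  finitely supported \<open>g\<close> with \<open>g + \<Delta> g\<close> close to \<open>f + h\<close>; as \<open>J\<^sup>* J\<close> is positive, \<open>g\<close> is close
  to \<open>f\<close> and \<open>\<Delta> g\<close> is close to \<open>h\<close>, so \<open>(f, h)\<close> lies in the closure \<open>\<Delta>\<close>.  Conversely, if
  \<open>(f, h)\<close> lies in that closure, then \<open>f + h = f' + h'\<close> for some \<open>(f', h')\<close> in \<open>J\<^sup>* J\<close>, and
  \<open>f = f'\<close> by the maximum principle.

  For the second identity, the vectors \<open>w\<^sub>x\<close> satisfy \<open>\<Delta> w\<^sub>x = \<delta>\<^sub>x\<close>.  So \<open>J J\<^sup>*\<close>
  extends the Laplacian on their span, which is dense because a vector orthogonal to all
  \<open>w\<^sub>x\<close> is orthogonal to all dipoles and hence constant.  A vector in the kernel of the adjoint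
  of this Laplacian is orthogonal to every \<open>\<delta>\<^sub>x\<close>, that is, harmonic, so \<open>J\<^sup>*\<close>
  already annihilates it.
\<close>

section \<open>Hilbert spaces on a carrier\<close>

text \<open>
  Real Hilbert spaces in the carrier-based encoding; completeness is stated for Cauchy sequences
  with respect to \<open>hnorm\<close>.
\<close>

locale hilbert =
  fixes H :: "'h::real_vector hspace"
  assumes subspace_pts: "subspace (pts H)"
    and ip_commute: "ip H x y = ip H y x"
    and ip_add_left: "\<lbrakk>x \<in> pts H; y \<in> pts H; z \<in> pts H\<rbrakk> \<Longrightarrow> ip H (x + y) z = ip H x z + ip H y z"
    and ip_scaleR_left: "\<lbrakk>x \<in> pts H; y \<in> pts H\<rbrakk> \<Longrightarrow> ip H (a *\<^sub>R x) y = a * ip H x y"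
    and ip_nonneg: "x \<in> pts H \<Longrightarrow> 0 \<le> ip H x x"
    and ip_definite: "\<lbrakk>x \<in> pts H; ip H x x = 0\<rbrakk> \<Longrightarrow> x = 0"
    and complete: "\<lbrakk>\<And>n. X n \<in> pts H;
        \<And>e. e > 0 \<Longrightarrow> \<exists>N. \<forall>m\<ge>N. \<forall>n\<ge>N. hnorm H (X m - X n) < e\<rbrakk>
        \<Longrightarrow> \<exists>l\<in>pts H. (\<lambda>n. hnorm H (l - X n)) \<longlonglongrightarrow> 0"
begin

lemma pts_closed [simp]:
  "0 \<in> pts H"
  "\<lbrakk>x \<in> pts H; y \<in> pts H\<rbrakk> \<Longrightarrow> x + y \<in> pts H"
  "\<lbrakk>x \<in> pts H; y \<in> pts H\<rbrakk> \<Longrightarrow> x - y \<in> pts H"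
  "x \<in> pts H \<Longrightarrow> a *\<^sub>R x \<in> pts H"
  "x \<in> pts H \<Longrightarrow> - x \<in> pts H"
  using subspace_pts by (auto intro: subspace_0 subspace_add subspace_diff subspace_scale subspace_neg)

lemma ip_minus_left: "\<lbrakk>x \<in> pts H; y \<in> pts H\<rbrakk> \<Longrightarrow> ip H (- x) y = - ip H x y"
  using ip_scaleR_left[of x y "-1"] by simp

lemma ip_diff_left: "\<lbrakk>x \<in> pts H; y \<in> pts H; z \<in> pts H\<rbrakk> \<Longrightarrow> ip H (x - y) z = ip H x z - ip H y z"
  using ip_add_left[of x "- y" z] by (simp add: ip_minus_left)

lemma ip_zero_left: "x \<in> pts H \<Longrightarrow> ip H 0 x = 0"
  using ip_scaleR_left[of 0 x 0] by simp

lemma ip_add_right: "\<lbrakk>x \<in> pts H; y \<in> pts H; z \<in> pts H\<rbrakk> \<Longrightarrow> ip H z (x + y) = ip H z x + ip H z y"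
  by (metis ip_add_left ip_commute)

lemma ip_diff_right: "\<lbrakk>x \<in> pts H; y \<in> pts H; z \<in> pts H\<rbrakk> \<Longrightarrow> ip H z (x - y) = ip H z x - ip H z y"
  by (metis ip_diff_left ip_commute)

lemma ip_scaleR_right: "\<lbrakk>x \<in> pts H; y \<in> pts H\<rbrakk> \<Longrightarrow> ip H y (a *\<^sub>R x) = a * ip H y x"
  by (metis ip_scaleR_left ip_commute)

lemma ip_minus_right: "\<lbrakk>x \<in> pts H; y \<in> pts H\<rbrakk> \<Longrightarrow> ip H y (- x) = - ip H y x"
  by (metis ip_minus_left ip_commute)

lemma ip_zero_right: "x \<in> pts H \<Longrightarrow> ip H x 0 = 0"
  by (metis ip_zero_left ip_commute)

lemmas ip_linear = ip_add_left ip_add_right ip_diff_left ip_diff_right ip_scaleR_left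
  ip_scaleR_right ip_minus_left ip_minus_right ip_zero_left ip_zero_right

lemma ip_sum_left:
  assumes "\<And>i. i \<in> I \<Longrightarrow> X i \<in> pts H" "y \<in> pts H"
  shows "ip H (\<Sum>i\<in>I. X i) y = (\<Sum>i\<in>I. ip H (X i) y)"
  using assms(1)
proof (induction I rule: infinite_finite_induct)
  case (insert i I)
  have "(\<Sum>i\<in>I. X i) \<in> pts H" using insert.prems subspace_pts by (intro subspace_sum) auto
  then show ?case using insert assms(2) by (simp add: ip_linear)
qed (simp_all add: ip_linear assms(2))

lemma hnorm_nonneg [simp]: "x \<in> pts H \<Longrightarrow> 0 \<le> hnorm H x"
  by (simp add: hnorm_def ip_nonneg)

lemma hnorm_power2: "x \<in> pts H \<Longrightarrow> (hnorm H x)\<^sup>2 = ip H x x"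
  by (simp add: hnorm_def ip_nonneg)

lemma sqnorm_diff_scaled:
  assumes "x \<in> pts H" "y \<in> pts H"
  shows "ip H (x - t *\<^sub>R y) (x - t *\<^sub>R y) = ip H x x - 2 * t * ip H x y + t\<^sup>2 * ip H y y"
  using assms ip_commute[of x y] by (simp add: ip_linear algebra_simps power2_eq_square)

text \<open>The variational inequality behind both the Cauchy-Schwarz inequality and the projection
  theorem: if moving along \<open>y\<close> decreases the squared norm of \<open>x\<close> by at most \<open>e\<close>, then
  \<open>x\<close> is orthogonal to the normalised \<open>y\<close> up to \<open>sqrt e\<close>.\<close>

lemma almost_minimal_almost_orthogonal:
  assumes xy: "x \<in> pts H" "y \<in> pts H"
    and min: "\<And>t. ip H x x \<le> ip H (x - t *\<^sub>R y) (x - t *\<^sub>R y) + e"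
  shows "\<bar>ip H x y\<bar> \<le> sqrt e * hnorm H y"
proof (cases "ip H y y = 0")
  case True
  then have "y = 0" using xy ip_definite by blast
  then show ?thesis using xy by (simp add: ip_linear hnorm_def)
next
  case False
  then have q: "ip H y y > 0" using xy ip_nonneg by (simp add: less_le)
  \<comment> \<open>the minimum of the quadratic polynomial \<open>sqnorm_diff_scaled\<close> in \<open>t\<close>\<close>
  define t where "t = ip H x y / ip H y y"
  have "0 \<le> - 2 * t * ip H x y + t\<^sup>2 * ip H y y + e"
    using min[of t] xy by (simp add: sqnorm_diff_scaled)
  also have "\<dots> = e - (ip H x y)\<^sup>2 / ip H y y"
    using q by (simp add: t_def power2_eq_square field_simps)
  finally have "(ip H x y)\<^sup>2 \<le> e * ip H y y"
    using q by (simp add: field_simps)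
  then have "sqrt ((ip H x y)\<^sup>2) \<le> sqrt (e * ip H y y)" by (rule real_sqrt_le_mono)
  then show ?thesis by (simp add: real_sqrt_mult hnorm_def)
qed

lemma Cauchy_Schwarz:
  assumes "x \<in> pts H" "y \<in> pts H"
  shows "\<bar>ip H x y\<bar> \<le> hnorm H x * hnorm H y"
  using almost_minimal_almost_orthogonal[OF assms, of "ip H x x"] assms
  by (simp add: hnorm_def ip_nonneg)

lemma tendsto_ip_left:
  assumes "x \<in> pts H" "y \<in> pts H" "\<And>n. X n \<in> pts H" "(\<lambda>n. hnorm H (x - X n)) \<longlonglongrightarrow> 0"
  shows "(\<lambda>n. ip H (X n) y) \<longlonglongrightarrow> ip H x y"
proof -
  have "(\<lambda>n. ip H (x - X n) y) \<longlonglongrightarrow> 0"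
  proof (rule Lim_null_comparison)
    show "\<forall>\<^sub>F n in sequentially. norm (ip H (x - X n) y) \<le> hnorm H (x - X n) * hnorm H y"
      using assms by (auto intro!: always_eventually Cauchy_Schwarz)
    show "(\<lambda>n. hnorm H (x - X n) * hnorm H y) \<longlonglongrightarrow> 0"
      using tendsto_mult_left_zero[OF assms(4)] by simp
  qed
  then have "(\<lambda>n. ip H x y - ip H (x - X n) y) \<longlonglongrightarrow> ip H x y - 0"
    by (intro tendsto_intros)
  then show ?thesis using assms by (simp add: ip_linear)
qed

text \<open>
  Orthogonal projection onto the closure of a subspace.  A minimising sequence is Cauchy because
  the difference of two of its members lies in \<open>M\<close> and so is almost orthogonal to both residuals.
\<close>

lemma projection:
  assumes M: "subspace M" "M \<subseteq> pts H" and x: "x \<in> pts H"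
  obtains p where "p \<in> pts H" "\<And>e. e > 0 \<Longrightarrow> \<exists>m\<in>M. hnorm H (p - m) < e"
    "\<And>y. y \<in> M \<Longrightarrow> ip H (x - p) y = 0"
proof -
  define d where "d = (INF m\<in>M. ip H (x - m) (x - m))"
  have bdd: "bdd_below ((\<lambda>m. ip H (x - m) (x - m)) ` M)"
    using M x by (intro bdd_belowI[of _ 0]) (auto intro!: ip_nonneg)
  have ne: "M \<noteq> {}" using subspace_0[OF M(1)] by blast
  have "\<exists>m. m \<in> M \<and> ip H (x - m) (x - m) < d + 1 / real (Suc n)" for n
    using cInf_lessD[of "(\<lambda>m. ip H (x - m) (x - m)) ` M" "d + 1 / real (Suc n)"] ne
    by (auto simp: d_def)
  then obtain m where m: "\<And>n. m n \<in> M"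
    and md: "\<And>n. ip H (x - m n) (x - m n) < d + 1 / real (Suc n)" by metis
  have mV [simp]: "m n \<in> pts H" for n using m M by blast
  define s where "s n = sqrt (1 / real (Suc n))" for n
  have s0: "s \<longlonglongrightarrow> 0"
    unfolding s_def using tendsto_real_sqrt[OF LIMSEQ_inverse_real_of_nat]
    by (simp add: inverse_eq_divide)
  have orth: "\<bar>ip H (x - m n) y\<bar> \<le> s n * hnorm H y" if y: "y \<in> M" for n y
    unfolding s_def
  proof (rule almost_minimal_almost_orthogonal)
    fix t
    have "m n + t *\<^sub>R y \<in> M" using M m y by (intro subspace_add subspace_scale) auto
    then have "d \<le> ip H (x - (m n + t *\<^sub>R y)) (x - (m n + t *\<^sub>R y))"
      unfolding d_def by (intro cINF_lower bdd)
    then show "ip H (x - m n) (x - m n) \<le> ip H (x - m n - t *\<^sub>R y) (x - m n - t *\<^sub>R y) + 1 / real (Suc n)"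
      using md[of n] by (simp add: diff_diff_eq)
  qed (use x y M in auto)
  have dist: "hnorm H (m i - m j) \<le> s i + s j" for i j
  proof -
    let ?y = "m i - m j"
    have y: "?y \<in> M" using M m by (intro subspace_diff) auto
    have "(hnorm H ?y)\<^sup>2 = ip H (x - m j) ?y - ip H (x - m i) ?y"
      using x by (simp add: hnorm_power2 ip_linear)
    also have "\<dots> \<le> (s i + s j) * hnorm H ?y"
      using orth[OF y, of i] orth[OF y, of j] by (simp add: algebra_simps)
    finally show ?thesis
      by (cases "hnorm H ?y = 0")
        (auto simp: power2_eq_square less_le s_def mult_le_cancel_right)
  qed
  have "\<exists>N. \<forall>i\<ge>N. \<forall>j\<ge>N. hnorm H (m i - m j) < e" if e: "e > 0" for e
  proof -
    obtain N where N: "\<And>n. n \<ge> N \<Longrightarrow> s n < e / 2"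
      using order_tendstoD(2)[OF s0, of "e / 2"] e by (auto simp: eventually_sequentially)
    have "hnorm H (m i - m j) < e" if "i \<ge> N" "j \<ge> N" for i j
      using dist[of i j] N[OF that(1)] N[OF that(2)] by linarith
    then show ?thesis by blast
  qed
  then obtain p where p: "p \<in> pts H" "(\<lambda>n. hnorm H (p - m n)) \<longlonglongrightarrow> 0"
    using complete[of m] by auto
  show ?thesis
  proof
    show "p \<in> pts H" by (fact p)
    show "\<exists>m\<in>M. hnorm H (p - m) < e" if "e > 0" for e
      using order_tendstoD(2)[OF p(2) that] m by (auto simp: eventually_sequentially)
    show "ip H (x - p) y = 0" if y: "y \<in> M" for y
    proof -
      have yV: "y \<in> pts H" using y M by blast
      have "(\<lambda>n. ip H x y - ip H (m n) y) \<longlonglongrightarrow> ip H x y - ip H p y"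
        by (intro tendsto_intros tendsto_ip_left) (use p yV in auto)
      moreover have "(\<lambda>n. ip H x y - ip H (m n) y) \<longlonglongrightarrow> 0"
      proof (rule Lim_null_comparison)
        show "\<forall>\<^sub>F n in sequentially. norm (ip H x y - ip H (m n) y) \<le> s n * hnorm H y"
          using orth[OF y] x yV by (auto intro!: always_eventually simp: ip_linear)
        show "(\<lambda>n. s n * hnorm H y) \<longlonglongrightarrow> 0"
          using tendsto_mult_left_zero[OF s0] by simp
      qed
      ultimately have "ip H x y - ip H p y = 0" by (rule LIMSEQ_unique)
      then show ?thesis using x p(1) yV by (simp add: ip_linear)
    qed
  qed
qed

lemma dense_if_orthogonal_trivial:
  assumes M: "subspace M" "M \<subseteq> pts H"
    and orth: "\<And>y. \<lbrakk>y \<in> pts H; \<And>m. m \<in> M \<Longrightarrow> ip H y m = 0\<rbrakk> \<Longrightarrow> y = 0"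
    and x: "x \<in> pts H" and e: "e > 0"
  shows "\<exists>m\<in>M. hnorm H (x - m) < e"
proof -
  obtain p where p: "p \<in> pts H" "\<And>e. e > 0 \<Longrightarrow> \<exists>m\<in>M. hnorm H (p - m) < e"
    "\<And>y. y \<in> M \<Longrightarrow> ip H (x - p) y = 0"
    using projection[OF M x] by metis
  have "x - p = 0" using orth[of "x - p"] x p by simp
  then show ?thesis using p(2)[OF e] by simp
qed

text \<open>The representing vector is a multiple of the residual of a vector outside the kernel.\<close>

lemma Riesz_representation:
  assumes add: "\<And>u v. \<lbrakk>u \<in> pts H; v \<in> pts H\<rbrakk> \<Longrightarrow> \<phi> (u + v) = \<phi> u + \<phi> v"
    and scale: "\<And>a u. u \<in> pts H \<Longrightarrow> \<phi> (a *\<^sub>R u) = a * \<phi> u"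
    and bound: "\<And>u. u \<in> pts H \<Longrightarrow> \<bar>\<phi> u\<bar> \<le> C * hnorm H u"
  shows "\<exists>!v. v \<in> pts H \<and> (\<forall>u\<in>pts H. ip H v u = \<phi> u)"
proof (rule ex_ex1I)
  have diff: "\<phi> (u - v) = \<phi> u - \<phi> v" if "u \<in> pts H" "v \<in> pts H" for u v
    using add[of u "- v"] scale[of v "-1"] that by simp
  show "\<exists>v. v \<in> pts H \<and> (\<forall>u\<in>pts H. ip H v u = \<phi> u)"
  proof (cases "\<forall>u\<in>pts H. \<phi> u = 0")
    case True
    then show ?thesis by (intro exI[of _ 0]) (simp add: ip_linear)
  next
    case False
    then obtain x where x: "x \<in> pts H" "\<phi> x \<noteq> 0" by blast
    define M where "M = {u \<in> pts H. \<phi> u = 0}"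
    have M: "subspace M" "M \<subseteq> pts H"
      using scale[of 0 0] by (auto simp: subspace_def M_def add scale)
    obtain p where p: "p \<in> pts H" "\<And>e. e > 0 \<Longrightarrow> \<exists>m\<in>M. hnorm H (p - m) < e"
      "\<And>y. y \<in> M \<Longrightarrow> ip H (x - p) y = 0"
      using projection[OF M x(1)] by metis
    have "\<phi> p = 0"
    proof (rule ccontr)
      assume "\<phi> p \<noteq> 0"
      then obtain m where m: "m \<in> M" "hnorm H (p - m) < \<bar>\<phi> p\<bar> / (\<bar>C\<bar> + 1)"
        using p(2)[of "\<bar>\<phi> p\<bar> / (\<bar>C\<bar> + 1)"] by auto
      have mV: "m \<in> pts H" using m M by blast
      have "\<bar>\<phi> p\<bar> = \<bar>\<phi> (p - m)\<bar>" using m p(1) diff mV by (simp add: M_def)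
      also have "\<dots> \<le> C * hnorm H (p - m)" using bound p(1) mV by simp
      also have "\<dots> \<le> (\<bar>C\<bar> + 1) * hnorm H (p - m)"
        using p(1) mV by (intro mult_right_mono) auto
      also have "\<dots> < \<bar>\<phi> p\<bar>" using m(2) by (simp add: field_simps)
      finally show False by simp
    qed
    define z where "z = x - p"
    have z: "z \<in> pts H" "\<phi> z = \<phi> x" using x p(1) diff \<open>\<phi> p = 0\<close> by (auto simp: z_def)
    have z0: "ip H z z \<noteq> 0" using ip_definite[of z] z x scale[of 0 0] by auto
    have "ip H ((\<phi> z / ip H z z) *\<^sub>R z) u = \<phi> u" if u: "u \<in> pts H" for u
    proof -
      have "u - (\<phi> u / \<phi> z) *\<^sub>R z \<in> M"
        using u z x by (simp add: M_def diff scale)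
      then have "ip H z (u - (\<phi> u / \<phi> z) *\<^sub>R z) = 0" using p(3) z_def by blast
      then have "ip H z u = \<phi> u / \<phi> z * ip H z z" using u z by (simp add: ip_linear)
      then show ?thesis using u z z0 x by (simp add: ip_linear)
    qed
    then show ?thesis using z by (intro exI[of _ "(\<phi> z / ip H z z) *\<^sub>R z"]) simp
  qed
next
  fix v w
  assume "v \<in> pts H \<and> (\<forall>u\<in>pts H. ip H v u = \<phi> u)" "w \<in> pts H \<and> (\<forall>u\<in>pts H. ip H w u = \<phi> u)"
  then have "v - w \<in> pts H" "ip H (v - w) (v - w) = 0" by (auto simp: ip_linear)
  then show "v = w" using ip_definite by fastforce
qed

end

section \<open>Closed operators and von Neumann's theorem\<close>

lemma graph_closure_sequence:
  assumes "(x, y) \<in> graph_closure H K A"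
    and "\<And>a b. (a, b) \<in> A \<Longrightarrow> 0 \<le> hnorm H (x - a) \<and> 0 \<le> hnorm K (y - b)"
  obtains X Y where "\<And>n. (X n, Y n) \<in> A"
    "(\<lambda>n. hnorm H (x - X n)) \<longlonglongrightarrow> 0" "(\<lambda>n. hnorm K (y - Y n)) \<longlonglongrightarrow> 0"
proof -
  have "\<exists>a b. (a, b) \<in> A \<and> hnorm H (x - a) < 1 / real (Suc n) \<and> hnorm K (y - b) < 1 / real (Suc n)" for n
  proof -
    have "1 / real (Suc n) > 0" by simp
    then show ?thesis using assms(1) unfolding graph_closure_def by blast
  qed
  then obtain X Y where XY: "\<And>n. (X n, Y n) \<in> A" "\<And>n. hnorm H (x - X n) < 1 / real (Suc n)"
    "\<And>n. hnorm K (y - Y n) < 1 / real (Suc n)" by metis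
  have nonneg: "0 \<le> hnorm H (x - X n)" "0 \<le> hnorm K (y - Y n)" for n
    using assms(2)[OF XY(1)] by auto
  have 0: "(\<lambda>n. 1 / real (Suc n)) \<longlonglongrightarrow> 0"
    using LIMSEQ_inverse_real_of_nat by (simp add: inverse_eq_divide)
  show ?thesis
  proof
    show "(\<lambda>n. hnorm H (x - X n)) \<longlonglongrightarrow> 0"
      by (rule real_tendsto_sandwich[OF _ _ tendsto_const 0]; rule always_eventually)
        (use nonneg XY in \<open>auto intro: less_imp_le simp del: of_nat_Suc\<close>)
    show "(\<lambda>n. hnorm K (y - Y n)) \<longlonglongrightarrow> 0"
      by (rule real_tendsto_sandwich[OF _ _ tendsto_const 0]; rule always_eventually)
        (use nonneg XY in \<open>auto intro: less_imp_le simp del: of_nat_Suc\<close>)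
  qed (fact XY(1))
qed

lemma hadjI:
  "\<lbrakk>k \<in> pts K; h \<in> pts H; \<And>x y. (x, y) \<in> A \<Longrightarrow> ip K y k = ip H x h\<rbrakk> \<Longrightarrow> (k, h) \<in> hadj H K A"
  by (auto simp: hadj_def)

lemma hadjD:
  assumes "(k, h) \<in> hadj H K A"
  shows "k \<in> pts K" "h \<in> pts H" "(x, y) \<in> A \<Longrightarrow> ip K y k = ip H x h"
  using assms by (auto simp: hadj_def)

lemma graph_closure_pts: "graph_closure H K A \<subseteq> pts H \<times> pts K"
  by (auto simp: graph_closure_def)

text \<open>The Hilbert space product, in which graphs of operators are subsets.\<close>

definition hprod :: "'h hspace \<Rightarrow> 'k hspace \<Rightarrow> ('h \<times> 'k) hspace"
  where "hprod H K = \<lparr> pts = pts H \<times> pts K,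
    ip = (\<lambda>p q. ip H (fst p) (fst q) + ip K (snd p) (snd q)) \<rparr>"

locale hilbert_pair = H: hilbert H + K: hilbert K
  for H :: "'h::real_vector hspace" and K :: "'k::real_vector hspace"
begin

lemma hnorm_hprod:
  assumes "x \<in> pts H" "y \<in> pts K"
  shows "hnorm (hprod H K) (x, y) = sqrt ((hnorm H x)\<^sup>2 + (hnorm K y)\<^sup>2)"
  using assms by (simp add: hnorm_def hprod_def H.ip_nonneg K.ip_nonneg)

lemma hnorm_le_hprod:
  assumes "x \<in> pts H" "y \<in> pts K"
  shows "hnorm H x \<le> hnorm (hprod H K) (x, y)" "hnorm K y \<le> hnorm (hprod H K) (x, y)"
  using assms by (auto simp: hnorm_hprod intro: real_le_rsqrt)

lemma hilbert_hprod: "hilbert (hprod H K)"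
proof
  show "subspace (pts (hprod H K))"
    by (auto simp: subspace_def hprod_def zero_prod_def)
  show "ip (hprod H K) x y = ip (hprod H K) y x" for x y
    by (simp add: hprod_def H.ip_commute K.ip_commute)
  show "ip (hprod H K) (x + y) z = ip (hprod H K) x z + ip (hprod H K) y z"
    if "x \<in> pts (hprod H K)" "y \<in> pts (hprod H K)" "z \<in> pts (hprod H K)" for x y z
    using that by (auto simp: hprod_def H.ip_linear K.ip_linear)
  show "ip (hprod H K) (a *\<^sub>R x) y = a * ip (hprod H K) x y"
    if "x \<in> pts (hprod H K)" "y \<in> pts (hprod H K)" for a x y
    using that by (auto simp: hprod_def H.ip_linear K.ip_linear algebra_simps)
  show "0 \<le> ip (hprod H K) x x" if "x \<in> pts (hprod H K)" for x
    using that by (auto simp: hprod_def H.ip_nonneg K.ip_nonneg)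
  show "x = 0" if "x \<in> pts (hprod H K)" "ip (hprod H K) x x = 0" for x
  proof -
    have x: "fst x \<in> pts H" "snd x \<in> pts K" using that(1) by (auto simp: hprod_def)
    then have "ip H (fst x) (fst x) = 0" "ip K (snd x) (snd x) = 0"
      using that(2) H.ip_nonneg[OF x(1)] K.ip_nonneg[OF x(2)] by (auto simp: hprod_def)
    then show "x = 0" using x H.ip_definite K.ip_definite by (simp add: prod_eq_iff)
  qed
next
  fix Z :: "nat \<Rightarrow> 'h \<times> 'k"
  assume Z: "\<And>n. Z n \<in> pts (hprod H K)"
    and Cauchy: "\<And>e. e > 0 \<Longrightarrow> \<exists>N. \<forall>m\<ge>N. \<forall>n\<ge>N. hnorm (hprod H K) (Z m - Z n) < e"
  define X Y where "X n = fst (Z n)" and "Y n = snd (Z n)" for n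
  have Z_eq: "Z n = (X n, Y n)" and XY: "X n \<in> pts H" "Y n \<in> pts K" for n
    using Z[of n] by (auto simp: X_def Y_def hprod_def)
  have le: "hnorm H (X m - X n) \<le> hnorm (hprod H K) (Z m - Z n)"
    "hnorm K (Y m - Y n) \<le> hnorm (hprod H K) (Z m - Z n)" for m n
    using hnorm_le_hprod[of "X m - X n" "Y m - Y n"] XY by (simp_all add: Z_eq)
  obtain x where x: "x \<in> pts H" "(\<lambda>n. hnorm H (x - X n)) \<longlonglongrightarrow> 0"
    using H.complete[of X] XY Cauchy le(1) by (meson le_less_trans)
  obtain y where y: "y \<in> pts K" "(\<lambda>n. hnorm K (y - Y n)) \<longlonglongrightarrow> 0"
    using K.complete[of Y] XY Cauchy le(2) by (meson le_less_trans)
  have "(\<lambda>n. sqrt ((hnorm H (x - X n))\<^sup>2 + (hnorm K (y - Y n))\<^sup>2)) \<longlonglongrightarrow> sqrt (0\<^sup>2 + 0\<^sup>2)"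
    by (intro tendsto_intros x y)
  then have "(\<lambda>n. hnorm (hprod H K) ((x, y) - Z n)) \<longlonglongrightarrow> 0"
    using x(1) y(1) XY by (simp add: Z_eq hnorm_hprod)
  then show "\<exists>l\<in>pts (hprod H K). (\<lambda>n. hnorm (hprod H K) (l - Z n)) \<longlonglongrightarrow> 0"
    using x(1) y(1) by (intro bexI[of _ "(x, y)"]) (auto simp: hprod_def)
qed

lemma graph_closure_superset:
  assumes "A \<subseteq> pts H \<times> pts K"
  shows "A \<subseteq> graph_closure H K A"
proof
  fix p assume p: "p \<in> A"
  have "hnorm H (fst p - fst p) = 0" "hnorm K (snd p - snd p) = 0"
    by (simp_all add: hnorm_def H.ip_linear K.ip_linear)
  then show "p \<in> graph_closure H K A"
    using p assms by (cases p) (auto simp: graph_closure_def intro!: bexI[of _ p])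
qed

text \<open>The relation that defines the adjoint passes to the graph closure.\<close>

lemma adjoint_relation_closure:
  assumes A: "A \<subseteq> pts H \<times> pts K" and kh: "k \<in> pts K" "h \<in> pts H"
    and eq: "\<And>x y. (x, y) \<in> A \<Longrightarrow> ip K y k = ip H x h"
    and xy: "(x, y) \<in> graph_closure H K A"
  shows "ip K y k = ip H x h"
proof -
  have V: "x \<in> pts H" "y \<in> pts K" using xy by (auto simp: graph_closure_def)
  obtain X Y where XY: "\<And>n. (X n, Y n) \<in> A"
    "(\<lambda>n. hnorm H (x - X n)) \<longlonglongrightarrow> 0" "(\<lambda>n. hnorm K (y - Y n)) \<longlonglongrightarrow> 0"
  proof (rule graph_closure_sequence[OF xy])
    fix a b assume "(a, b) \<in> A"
    then show "0 \<le> hnorm H (x - a) \<and> 0 \<le> hnorm K (y - b)" using A V by auto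
  qed blast
  have XYV: "X n \<in> pts H" "Y n \<in> pts K" for n using XY(1) A by auto
  have "(\<lambda>n. ip K (Y n) k) \<longlonglongrightarrow> ip K y k"
    by (rule K.tendsto_ip_left) (use V kh XYV XY in auto)
  moreover have "(\<lambda>n. ip K (Y n) k) \<longlonglongrightarrow> ip H x h"
    using H.tendsto_ip_left[OF V(1) kh(2) XYV(1) XY(2)] eq[OF XY(1)] by simp
  ultimately show ?thesis by (rule LIMSEQ_unique)
qed

lemma hadj_graph_closure:
  assumes A: "A \<subseteq> pts H \<times> pts K"
  shows "hadj H K (graph_closure H K A) = hadj H K A"
proof (intro equalityI subrelI)
  fix k h assume "(k, h) \<in> hadj H K (graph_closure H K A)"
  then show "(k, h) \<in> hadj H K A"
    using graph_closure_superset[OF A] by (auto simp: hadj_def)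
next
  fix k h assume kh: "(k, h) \<in> hadj H K A"
  show "(k, h) \<in> hadj H K (graph_closure H K A)"
    using adjoint_relation_closure[OF A hadjD(1,2)[OF kh]] hadjD[OF kh]
    by (intro hadjI) blast+
qed

text \<open>The orthogonal complement of the graph of \<open>J\<close> in the product space is the rotated graph of
  \<open>J\<^sup>*\<close>; projecting \<open>(a, b)\<close> onto the graph of \<open>J\<close> therefore splits it as below.\<close>

lemma graph_decomposition:
  assumes B: "subspace B" "B \<subseteq> pts H \<times> pts K" and ab: "a \<in> pts H" "b \<in> pts K"
  obtains f m where "(f, m) \<in> graph_closure H K B"
    "(b - m, f - a) \<in> hadj H K (graph_closure H K B)"
proof -
  interpret P: hilbert "hprod H K" by (rule hilbert_hprod)
  have "B \<subseteq> pts (hprod H K)" "(a, b) \<in> pts (hprod H K)" using B ab by (auto simp: hprod_def)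
  then obtain p where p: "p \<in> pts (hprod H K)"
    "\<And>e. e > 0 \<Longrightarrow> \<exists>q\<in>B. hnorm (hprod H K) (p - q) < e"
    "\<And>q. q \<in> B \<Longrightarrow> ip (hprod H K) ((a, b) - p) q = 0"
    using P.projection[OF B(1)] by metis
  obtain f m where fm: "p = (f, m)" "f \<in> pts H" "m \<in> pts K"
    using p(1) by (auto simp: hprod_def)
  have "\<exists>(x, y)\<in>B. hnorm H (f - x) < e \<and> hnorm K (m - y) < e" if e: "e > 0" for e
  proof -
    obtain x y where xy: "(x, y) \<in> B" "hnorm (hprod H K) (f - x, m - y) < e"
      using p(2)[OF e] fm by auto
    then have "x \<in> pts H" "y \<in> pts K" using B by auto
    then show ?thesis
      using xy hnorm_le_hprod[of "f - x" "m - y"] fm by (intro bexI[of _ "(x, y)"]) auto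
  qed
  then have J: "(f, m) \<in> graph_closure H K B" using fm by (auto simp: graph_closure_def)
  have "(b - m, f - a) \<in> hadj H K B"
  proof (rule hadjI)
    fix x y assume xy: "(x, y) \<in> B"
    then have V: "x \<in> pts H" "y \<in> pts K" using B by auto
    have "ip H (a - f) x + ip K (b - m) y = 0"
      using p(3)[OF xy] by (simp add: fm hprod_def)
    then show "ip K y (b - m) = ip H x (f - a)"
      using V ab fm H.ip_commute[of x] K.ip_commute[of y] by (simp add: H.ip_linear K.ip_linear)
  qed (use fm ab in auto)
  then show ?thesis using that J hadj_graph_closure[OF B(2)] by blast
qed

end

context hilbert
begin

lemma graph_closure_hadj: "graph_closure H H (hadj H H A) \<subseteq> hadj H H A" if A: "A \<subseteq> pts H \<times> pts H"
proof (rule subrelI)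
  interpret hilbert_pair H H by unfold_locales
  fix k h assume kh: "(k, h) \<in> graph_closure H H (hadj H H A)"
  show "(k, h) \<in> hadj H H A"
  proof (rule hadjI)
    show "k \<in> pts H" "h \<in> pts H" using kh by (auto simp: graph_closure_def)
    fix x y assume xy: "(x, y) \<in> A"
    have "ip H h x = ip H k y"
      by (rule adjoint_relation_closure[OF _ _ _ _ kh])
        (use A xy in \<open>auto simp: hadj_def ip_commute\<close>)
    then show "ip H y k = ip H x h" by (simp add: ip_commute)
  qed
qed

text \<open>
  Given \<open>(k, h)\<close> in the adjoint, pick \<open>(k', h')\<close> in \<open>T\<close> with the same value of \<open>1 + T\<close>; then
  \<open>k - k'\<close> is orthogonal to the range of \<open>1 + T\<close>, so it vanishes.
\<close>

lemma symmetric_surjective_self_adjoint: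
  assumes T: "T \<subseteq> pts H \<times> pts H" and dense: "densely_defined H T"
    and sym: "\<And>x y x' y'. \<lbrakk>(x, y) \<in> T; (x', y') \<in> T\<rbrakk> \<Longrightarrow> ip H y x' = ip H x y'"
    and surj: "\<And>h. h \<in> pts H \<Longrightarrow> \<exists>k m. (k, m) \<in> T \<and> k + m = h"
  shows "self_adjoint H T"
  unfolding self_adjoint_def
proof (intro conjI equalityI subrelI dense)
  fix k h assume "(k, h) \<in> T"
  then show "(k, h) \<in> hadj H H T" using T sym by (intro hadjI) auto
next
  fix k h assume kh: "(k, h) \<in> hadj H H T"
  note V = hadjD(1,2)[OF kh]
  obtain k' h' where k': "(k', h') \<in> T" "k' + h' = k + h" using surj[of "k + h"] V by auto
  have V': "k' \<in> pts H" "h' \<in> pts H" using k' T by auto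
  have h_eq: "h' = k + h - k'" using k' by (simp add: algebra_simps)
  obtain x y where xy: "(x, y) \<in> T" "x + y = k - k'" using surj[of "k - k'"] V V' by auto
  have W: "x \<in> pts H" "y \<in> pts H" using xy T by auto
  have "ip H y k = ip H x h" "ip H y k' = ip H x h'" using hadjD(3)[OF kh] sym xy k' by auto
  then have "ip H (x + y) (k - k') = 0" using V V' W by (simp add: ip_linear h_eq)
  then have "k - k' = 0" using xy V V' by (intro ip_definite) auto
  then show "(k, h) \<in> T" using k' h_eq by simp
qed

end

section \<open>Square-summable functions\<close>

lemma L2_iff: "f \<in> pts L2 \<longleftrightarrow> (\<lambda>x. (f x)\<^sup>2) summable_on UNIV"
  by (simp add: L2_def)

lemma ip_L2: "ip L2 f g = (\<Sum>\<^sub>\<infinity>x. f x * g x)"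
  by (simp add: L2_def)

lemma L2_mult_summable:
  assumes "f \<in> pts L2" "g \<in> pts L2"
  shows "(\<lambda>x. f x * g x) summable_on UNIV"
proof -
  have "(\<lambda>x. norm (f x * g x)) summable_on UNIV"
  proof (rule summable_on_comparison_test)
    show "(\<lambda>x. (f x)\<^sup>2 + (g x)\<^sup>2) summable_on UNIV"
      using assms by (intro summable_on_add) (auto simp: L2_iff)
    fix x
    have "0 \<le> (\<bar>f x\<bar> - \<bar>g x\<bar>)\<^sup>2" "0 \<le> \<bar>f x\<bar> * \<bar>g x\<bar>" by simp_all
    then have "\<bar>f x\<bar> * \<bar>g x\<bar> \<le> (f x)\<^sup>2 + (g x)\<^sup>2"
      unfolding power2_diff power2_abs by linarith
    then show "norm (f x * g x) \<le> (f x)\<^sup>2 + (g x)\<^sup>2" by (simp add: abs_mult)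
  qed simp
  then show ?thesis using summable_on_iff_abs_summable_on_real by blast
qed

lemma finite_support_L2: "finite {x. f x \<noteq> 0} \<Longrightarrow> f \<in> pts L2"
  unfolding L2_iff
  by (rule iffD1[OF summable_on_cong_neutral[of UNIV "{x. f x \<noteq> 0}"] summable_on_finite]) auto

lemma subspace_L2: "subspace (pts L2)"
  unfolding subspace_def
proof (intro conjI ballI allI)
  show "0 \<in> pts L2" by (simp add: L2_iff)
  show "f + g \<in> pts L2" if "f \<in> pts L2" "g \<in> pts L2" for f g :: "'a \<Rightarrow> real"
  proof -
    have "(\<lambda>x. (f x)\<^sup>2 + (g x)\<^sup>2 + 2 * (f x * g x)) summable_on UNIV"
      using that by (intro summable_on_add summable_on_cmult_right L2_mult_summable) (auto simp: L2_iff)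
    then show ?thesis by (simp add: L2_iff power2_sum algebra_simps)
  qed
  show "a *\<^sub>R f \<in> pts L2" if "f \<in> pts L2" for a and f :: "'a \<Rightarrow> real"
    using that by (auto simp: L2_iff scaleR_fun_def power_mult_distrib intro: summable_on_cmult_right)
qed

lemma abs_le_hnorm_L2:
  assumes "f \<in> pts L2"
  shows "\<bar>f x\<bar> \<le> hnorm L2 f"
proof -
  have "(\<Sum>y\<in>{x}. (f y)\<^sup>2) \<le> (\<Sum>\<^sub>\<infinity>y. (f y)\<^sup>2)"
    using assms by (intro finite_sum_le_infsum) (auto simp: L2_iff)
  then have "sqrt ((f x)\<^sup>2) \<le> hnorm L2 f"
    unfolding hnorm_def ip_L2 by (intro real_sqrt_le_mono) (simp add: power2_eq_square)
  then show ?thesis by simp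
qed

text \<open>Lower semicontinuity of the norm under pointwise convergence.\<close>

lemma hnorm_L2_le_pointwise_limit:
  assumes F: "\<And>n. F n \<in> pts L2" and lim: "\<And>x. (\<lambda>n. F n x) \<longlonglongrightarrow> f x"
    and bound: "\<forall>\<^sub>F n in sequentially. hnorm L2 (F n) \<le> e"
  shows "f \<in> pts L2" "hnorm L2 f \<le> e"
proof -
  \<comment> \<open>\<open>undefined\<close> is only used as some point of the index type, which is not empty\<close>
  have e: "e \<ge> 0"
  proof -
    obtain n where n: "hnorm L2 (F n) \<le> e" using bound by (auto simp: eventually_sequentially)
    have "0 \<le> \<bar>F n undefined\<bar>" by simp
    also have "\<dots> \<le> hnorm L2 (F n)" using F by (rule abs_le_hnorm_L2)
    finally show ?thesis using n by simp
  qed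
  have part: "(\<Sum>x\<in>A. (f x)\<^sup>2) \<le> e\<^sup>2" if A: "finite A" for A
  proof (rule tendsto_upperbound)
    show "(\<lambda>n. \<Sum>x\<in>A. (F n x)\<^sup>2) \<longlonglongrightarrow> (\<Sum>x\<in>A. (f x)\<^sup>2)"
      by (intro tendsto_intros lim)
    show "\<forall>\<^sub>F n in sequentially. (\<Sum>x\<in>A. (F n x)\<^sup>2) \<le> e\<^sup>2"
      using bound
    proof eventually_elim
      case (elim n)
      have "(\<Sum>x\<in>A. (F n x)\<^sup>2) \<le> (\<Sum>\<^sub>\<infinity>x. (F n x)\<^sup>2)"
        using F A by (intro finite_sum_le_infsum) (auto simp: L2_iff)
      also have "\<dots> = (hnorm L2 (F n))\<^sup>2"
        by (simp add: hnorm_def ip_L2 infsum_nonneg flip: power2_eq_square)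
      also have "\<dots> \<le> e\<^sup>2"
        using elim abs_le_hnorm_L2[OF F, of n undefined] by (intro power_mono) auto
      finally show ?case .
    qed
  qed simp
  have sum: "(\<lambda>x. (f x)\<^sup>2) summable_on UNIV"
    by (rule nonneg_bdd_above_summable_on) (use part in \<open>auto intro!: bdd_aboveI[of _ "e\<^sup>2"]\<close>)
  then show "f \<in> pts L2" by (simp add: L2_iff)
  have "(\<Sum>\<^sub>\<infinity>x. (f x)\<^sup>2) \<le> e\<^sup>2"
    using sum part by (intro infsum_le_finite_sums) auto
  then show "hnorm L2 f \<le> e"
    using e by (simp add: hnorm_def ip_L2 real_le_lsqrt flip: power2_eq_square)
qed

interpretation L2: hilbert "L2 :: ('a \<Rightarrow> real) hspace"
proof
  show "subspace (pts (L2 :: ('a \<Rightarrow> real) hspace))" by (rule subspace_L2)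
  show "ip L2 f g = ip L2 g f" for f g :: "'a \<Rightarrow> real" by (simp add: ip_L2 mult.commute)
  show "ip L2 (f + g) h = ip L2 f h + ip L2 g h"
    if "f \<in> pts L2" "g \<in> pts L2" "h \<in> pts L2" for f g h :: "'a \<Rightarrow> real"
    using that by (simp add: ip_L2 distrib_right infsum_add L2_mult_summable)
  show "ip L2 (a *\<^sub>R f) g = a * ip L2 f g" if "f \<in> pts L2" "g \<in> pts L2" for a and f g :: "'a \<Rightarrow> real"
    using that by (simp add: ip_L2 scaleR_fun_def mult.assoc infsum_cmult_right L2_mult_summable)
  show "0 \<le> ip L2 f f" for f :: "'a \<Rightarrow> real" by (simp add: ip_L2 infsum_nonneg)
  show "f = 0" if "f \<in> pts L2" "ip L2 f f = 0" for f :: "'a \<Rightarrow> real"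
    using abs_le_hnorm_L2[OF that(1)] that(2) by (auto simp: hnorm_def fun_eq_iff)
next
  fix F :: "nat \<Rightarrow> 'a \<Rightarrow> real"
  assume F: "\<And>n. F n \<in> pts L2"
    and Cauchy: "\<And>e. e > 0 \<Longrightarrow> \<exists>N. \<forall>m\<ge>N. \<forall>n\<ge>N. hnorm L2 (F m - F n) < e"
  have F_diff: "F m - F n \<in> pts L2" for m n
    using F subspace_L2 by (intro subspace_diff)
  have "Cauchy (\<lambda>n. F n x)" for x
  proof (rule metric_CauchyI)
    fix e :: real assume "e > 0"
    then obtain N where "\<forall>m\<ge>N. \<forall>n\<ge>N. hnorm L2 (F m - F n) < e" using Cauchy by blast
    moreover have "dist (F m x) (F n x) \<le> hnorm L2 (F m - F n)" for m n
      using abs_le_hnorm_L2[OF F_diff, of m n x] by (simp add: dist_real_def)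
    ultimately show "\<exists>M. \<forall>m\<ge>M. \<forall>n\<ge>M. dist (F m x) (F n x) < e"
      by (meson le_less_trans)
  qed
  then obtain f where f: "\<And>x. (\<lambda>n. F n x) \<longlonglongrightarrow> f x"
    unfolding Cauchy_convergent_iff convergent_def by metis
  have tail: "\<exists>N. \<forall>n\<ge>N. f - F n \<in> pts L2 \<and> hnorm L2 (f - F n) \<le> e" if "e > 0" for e
  proof -
    obtain N where N: "\<forall>m\<ge>N. \<forall>n\<ge>N. hnorm L2 (F m - F n) < e" using Cauchy \<open>e > 0\<close> by blast
    have "f - F n \<in> pts L2 \<and> hnorm L2 (f - F n) \<le> e" if n: "n \<ge> N" for n
    proof -
      have "(\<lambda>m. (F m - F n) x) \<longlonglongrightarrow> (f - F n) x" for x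
        using f by (auto intro!: tendsto_intros)
      moreover have "\<forall>\<^sub>F m in sequentially. hnorm L2 (F m - F n) \<le> e"
        using N n by (auto simp: eventually_sequentially intro!: exI[of _ N] less_imp_le)
      ultimately show ?thesis
        using hnorm_L2_le_pointwise_limit[of "\<lambda>m. F m - F n" "f - F n" e] F_diff by blast
    qed
    then show ?thesis by blast
  qed
  obtain N where "f - F N \<in> pts L2" using tail[of 1] by auto
  then have "f - F N + F N \<in> pts L2" using F subspace_L2 by (intro subspace_add)
  then have fV: "f \<in> pts L2" by simp
  moreover have "(\<lambda>n. hnorm L2 (f - F n)) \<longlonglongrightarrow> 0"
  proof (rule LIMSEQ_I)
    fix e :: real assume "e > 0"
    then obtain N where "\<forall>n\<ge>N. f - F n \<in> pts L2 \<and> hnorm L2 (f - F n) \<le> e / 2"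
      using tail[of "e / 2"] by auto
    then have "\<forall>n\<ge>N. norm (hnorm L2 (f - F n) - 0) < e"
      using \<open>e > 0\<close> by (auto simp: hnorm_def ip_L2 infsum_nonneg)
    then show "\<exists>N. \<forall>n\<ge>N. norm (hnorm L2 (f - F n) - 0) < e" by blast
  qed
  ultimately show "\<exists>l\<in>pts L2. (\<lambda>n. hnorm L2 (l - F n)) \<longlonglongrightarrow> 0" by blast
qed

section \<open>The energy space\<close>

lemma cls_linear:
  "cls (f + g) = cls f + cls g" "cls (f - g) = cls f - cls g" "cls (a *\<^sub>R f) = a *\<^sub>R cls f"
  "cls 0 = 0"
  by (simp_all add: plus_modconst.abs_eq minus_modconst.abs_eq scaleR_modconst.abs_eq zero_modconst_def
      plus_fun_def fun_diff_def)

lemma diff_q_cls: "diff_q (cls f) x y = f x - f y"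
  by (simp add: diff_q.abs_eq)

lemma cls_cases: obtains f where "u = cls f"
  using modconst.abs_induct[of "\<lambda>u. \<exists>f. u = cls f" u] by blast

lemma diff_q_linear:
  "diff_q (u + v) x y = diff_q u x y + diff_q v x y"
  "diff_q (a *\<^sub>R u) x y = a * diff_q u x y"
  by (cases u rule: cls_cases, cases v rule: cls_cases,
      simp add: diff_q_cls flip: cls_linear, cases u rule: cls_cases,
      simp add: diff_q_cls scaleR_fun_def algebra_simps flip: cls_linear)

lemma diff_q_minus: "diff_q (u - v) x y = diff_q u x y - diff_q v x y"
  by (metis add_diff_cancel_right' diff_add_cancel diff_q_linear(1))

lemma diff_q_eq_0D: "(\<And>x. diff_q u x y = 0) \<Longrightarrow> u = 0"
  by (cases u rule: cls_cases) (auto simp: diff_q_cls zero_modconst_def modconst.abs_eq_iff)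

lemma laplacian_q_eq: "laplacian_q c u x = (\<Sum>y | c x y > 0. c x y * diff_q u x y)"
  by (cases u rule: cls_cases) (simp add: laplacian_q.abs_eq laplacian_def diff_q_cls)

text \<open>
  The weighted gradient embeds the energy space isometrically as a closed subspace of the
  square-summable functions on ordered pairs of vertices.  Each edge occurs as two ordered pairs,
  whence the division by 2.
\<close>

definition grad :: "('v \<Rightarrow> 'v \<Rightarrow> real) \<Rightarrow> 'v modconst \<Rightarrow> 'v \<times> 'v \<Rightarrow> real"
  where "grad c u = (\<lambda>(x, y). sqrt (c x y / 2) * diff_q u x y)"

lemma grad_linear: "grad c (u + v) = grad c u + grad c v" "grad c (u - v) = grad c u - grad c v"
  "grad c (a *\<^sub>R u) = a *\<^sub>R grad c u"
  by (auto simp: grad_def fun_eq_iff diff_q_linear diff_q_minus algebra_simps scaleR_fun_def)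

context network
begin

lemma HE_iff: "u \<in> pts (HE c) \<longleftrightarrow> grad c u \<in> pts L2"
proof (cases u rule: cls_cases)
  case (1 f)
  have eq: "(grad c u p)\<^sup>2 = 1/2 * (case p of (x, y) \<Rightarrow> c x y * (f x - f y) * (f x - f y))" for p
    using nonneg[of "fst p" "snd p"]
    by (cases p) (simp add: 1 grad_def diff_q_cls power_mult_distrib, simp add: power2_eq_square)
  show ?thesis
    unfolding L2_iff eq
    by (subst summable_on_cmult_right') (simp_all add: 1 HE_def finite_energy_q.abs_eq finite_energy_def)
qed

lemma ip_HE: "ip (HE c) u v = ip L2 (grad c u) (grad c v)"
proof (cases u rule: cls_cases; cases v rule: cls_cases)
  fix f g assume uv: "u = cls f" "v = cls g"
  have eq: "grad c u p * grad c v p = 1/2 * (case p of (x, y) \<Rightarrow> c x y * (f x - f y) * (g x - g y))" for p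
    using nonneg[of "fst p" "snd p"] by (cases p) (auto simp: uv grad_def diff_q_cls algebra_simps)
  show ?thesis
    unfolding ip_L2 eq infsum_cmult_right' by (simp add: uv HE_def energy_q.abs_eq energy_def)
qed

lemma hnorm_HE: "hnorm (HE c) u = hnorm L2 (grad c u)"
  by (simp add: hnorm_def ip_HE)

text \<open>Differences are bounded functionals on the energy space, by induction along a path.\<close>

lemma diff_q_bounded: "\<exists>C. \<forall>u\<in>pts (HE c). \<bar>diff_q u x y\<bar> \<le> C * hnorm (HE c) u"
  using connected[of x y]
proof (induction rule: rtrancl_induct)
  case base
  have "diff_q u x x = 0" for u :: "'v modconst" by (cases u rule: cls_cases) (simp add: diff_q_cls)
  then show ?case by (intro exI[of _ 0]) simp
next
  case (step y z)
  then obtain C where C: "\<And>u. u \<in> pts (HE c) \<Longrightarrow> \<bar>diff_q u x y\<bar> \<le> C * hnorm (HE c) u" by blast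
  let ?s = "sqrt (c y z / 2)"
  have s: "?s > 0" using step by simp
  show ?case
  proof (intro exI[of _ "C + 1 / ?s"] ballI)
    fix u assume u: "u \<in> pts (HE c)"
    have "\<bar>grad c u (y, z)\<bar> \<le> hnorm (HE c) u"
      using abs_le_hnorm_L2 u by (simp add: HE_iff hnorm_HE)
    then have "\<bar>diff_q u y z\<bar> \<le> 1 / ?s * hnorm (HE c) u"
      using s by (simp add: grad_def abs_mult field_simps)
    moreover have "diff_q u x z = diff_q u x y + diff_q u y z"
      by (cases u rule: cls_cases) (simp add: diff_q_cls)
    ultimately show "\<bar>diff_q u x z\<bar> \<le> (C + 1 / ?s) * hnorm (HE c) u"
      using C[OF u] by (simp add: distrib_right)
  qed
qed

sublocale HE: hilbert "HE c"
proof
  have grad_0: "grad c 0 = 0" using grad_linear(3)[of c 0 0] by simp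
  show "subspace (pts (HE c))"
    using subspace_L2 by (auto simp: subspace_def HE_iff grad_linear grad_0)
  show "ip (HE c) u v = ip (HE c) v u" for u v by (simp add: ip_HE L2.ip_commute)
  show "ip (HE c) (u + v) w = ip (HE c) u w + ip (HE c) v w"
    if "u \<in> pts (HE c)" "v \<in> pts (HE c)" "w \<in> pts (HE c)" for u v w
    using that by (simp add: ip_HE HE_iff grad_linear L2.ip_linear)
  show "ip (HE c) (a *\<^sub>R u) v = a * ip (HE c) u v"
    if "u \<in> pts (HE c)" "v \<in> pts (HE c)" for a u v
    using that by (simp add: ip_HE HE_iff grad_linear L2.ip_linear)
  show "0 \<le> ip (HE c) u u" if "u \<in> pts (HE c)" for u
    using that by (simp add: ip_HE HE_iff L2.ip_nonneg)
  show "u = 0" if u: "u \<in> pts (HE c)" "ip (HE c) u u = 0" for u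
  proof (rule diff_q_eq_0D)
    fix x
    obtain C where "\<forall>u\<in>pts (HE c). \<bar>diff_q u x undefined\<bar> \<le> C * hnorm (HE c) u"
      using diff_q_bounded by blast
    then have "\<bar>diff_q u x undefined\<bar> \<le> C * hnorm (HE c) u" using u(1) by blast
    then show "diff_q u x undefined = 0" using u(2) by (simp add: hnorm_def)
  qed
next
  fix U :: "nat \<Rightarrow> 'v modconst"
  assume U: "\<And>n. U n \<in> pts (HE c)"
    and Cauchy: "\<And>e. e > 0 \<Longrightarrow> \<exists>N. \<forall>m\<ge>N. \<forall>n\<ge>N. hnorm (HE c) (U m - U n) < e"
  have U_diff: "U m - U n \<in> pts (HE c)" for m n
    using U by (simp add: HE_iff grad_linear)
  obtain g where g: "g \<in> pts L2" "(\<lambda>n. hnorm L2 (g - grad c (U n))) \<longlonglongrightarrow> 0"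
    using L2.complete[of "\<lambda>n. grad c (U n)"] U Cauchy by (auto simp: HE_iff hnorm_HE grad_linear)
  \<comment> \<open>the representatives that vanish at an arbitrary base vertex converge pointwise\<close>
  have "Cauchy (\<lambda>n. diff_q (U n) x undefined)" for x
  proof (rule metric_CauchyI)
    fix e :: real assume e: "e > 0"
    obtain C where C: "\<And>u. u\<in>pts (HE c) \<Longrightarrow> \<bar>diff_q u x undefined\<bar> \<le> C * hnorm (HE c) u"
      using diff_q_bounded by blast
    obtain N where N: "\<forall>m\<ge>N. \<forall>n\<ge>N. hnorm (HE c) (U m - U n) < e / (\<bar>C\<bar> + 1)"
      using Cauchy[of "e / (\<bar>C\<bar> + 1)"] e by auto
    have "dist (diff_q (U m) x undefined) (diff_q (U n) x undefined) < e" if "m \<ge> N" "n \<ge> N" for m n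
    proof -
      have "\<bar>diff_q (U m - U n) x undefined\<bar> \<le> C * hnorm (HE c) (U m - U n)" using C U_diff by blast
      also have "\<dots> \<le> (\<bar>C\<bar> + 1) * hnorm (HE c) (U m - U n)"
        using U_diff by (intro mult_right_mono) (auto simp: hnorm_HE HE_iff)
      also have "\<dots> < e" using N that by (simp add: field_simps)
      finally show ?thesis by (simp add: dist_real_def diff_q_minus)
    qed
    then show "\<exists>M. \<forall>m\<ge>M. \<forall>n\<ge>M. dist (diff_q (U m) x undefined) (diff_q (U n) x undefined) < e" by blast
  qed
  then obtain f where f: "\<And>x. (\<lambda>n. diff_q (U n) x undefined) \<longlonglongrightarrow> f x"
    unfolding Cauchy_convergent_iff convergent_def by metis
  have "grad c (cls f) = g"
  proof
    fix p :: "'v \<times> 'v"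
    obtain x y where p: "p = (x, y)" by (cases p)
    have diff: "diff_q u x y = diff_q u x undefined - diff_q u y undefined" for u :: "'v modconst"
      by (cases u rule: cls_cases) (simp add: diff_q_cls)
    have "(\<lambda>n. sqrt (c x y / 2) * (diff_q (U n) x undefined - diff_q (U n) y undefined))
        \<longlonglongrightarrow> sqrt (c x y / 2) * (f x - f y)"
      by (intro tendsto_intros f)
    then have 1: "(\<lambda>n. grad c (U n) p) \<longlonglongrightarrow> grad c (cls f) p"
      by (simp add: p grad_def diff diff_q_cls)
    have "(\<lambda>n. (g - grad c (U n)) p) \<longlonglongrightarrow> 0"
    proof (rule Lim_null_comparison[OF always_eventually g(2)], rule allI)
      fix n
      have "g - grad c (U n) \<in> pts L2" using g(1) U[of n] by (simp only: HE_iff L2.pts_closed)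
      then show "norm ((g - grad c (U n)) p) \<le> hnorm L2 (g - grad c (U n))"
        unfolding real_norm_def by (rule abs_le_hnorm_L2)
    qed
    then have "(\<lambda>n. g p - (g - grad c (U n)) p) \<longlonglongrightarrow> g p - 0"
      by (intro tendsto_intros)
    then have 2: "(\<lambda>n. grad c (U n) p) \<longlonglongrightarrow> g p" by simp
    show "grad c (cls f) p = g p" using 1 2 by (rule LIMSEQ_unique)
  qed
  then show "\<exists>l\<in>pts (HE c). (\<lambda>n. hnorm (HE c) (l - U n)) \<longlonglongrightarrow> 0"
    using g by (intro bexI[of _ "cls f"]) (simp_all add: HE_iff hnorm_HE grad_linear)
qed

end

section \<open>Delta functions and the Laplacian\<close>

lemma delta_eq: "delta x y = (if y = x then 1 else 0)"
  by (auto simp: delta_def)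

lemma delta_L2: "delta x \<in> pts L2"
  by (rule finite_support_L2) (simp add: delta_eq)

lemma ip_L2_delta: "ip L2 (delta x) f = f x"
proof -
  have "ip L2 (delta x) f = (\<Sum>\<^sub>\<infinity>y\<in>{x}. delta x y * f y)"
    unfolding ip_L2 by (rule infsum_cong_neutral) (auto simp: delta_eq)
  then show ?thesis by (simp add: delta_eq)
qed

lemma span_delta_L2: "span (range delta) \<subseteq> pts L2"
  by (rule span_minimal) (auto simp: delta_L2 subspace_L2)

lemma laplacian_linear:
  "laplacian c 0 = 0"
  "laplacian c (f + g) = laplacian c f + laplacian c g"
  "laplacian c (f - g) = laplacian c f - laplacian c g"
  "laplacian c (a *\<^sub>R f) = a *\<^sub>R laplacian c f"
  by (auto simp: laplacian_def fun_eq_iff scaleR_fun_def sum.distrib sum_subtractf sum_distrib_left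
      algebra_simps)

lemma laplacian_q_cls: "laplacian_q c (cls f) = laplacian c f"
  by (simp add: laplacian_q.abs_eq)

lemma laplacian_q_linear:
  "laplacian_q c 0 = 0"
  "laplacian_q c (u + v) = laplacian_q c u + laplacian_q c v"
  "laplacian_q c (u - v) = laplacian_q c u - laplacian_q c v"
  "laplacian_q c (a *\<^sub>R u) = a *\<^sub>R laplacian_q c u"
  "laplacian_q c (- u) = - laplacian_q c u"
  by (cases u rule: cls_cases; cases v rule: cls_cases;
      metis cls_linear laplacian_q_cls laplacian_linear scaleR_minus1_left)+

context network
begin

lemma laplacian_delta:
  "laplacian c (delta x) = (\<Sum>y | c x y > 0. c x y *\<^sub>R (delta x - delta y))"
proof
  fix z
  have sum_at: "(\<Sum>y\<in>A. F y) v = (\<Sum>y\<in>A. F y v)" if "finite A" for A v and F :: "'v \<Rightarrow> 'v \<Rightarrow> real"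
    using that by induction auto
  show "laplacian c (delta x) z = (\<Sum>y | c x y > 0. c x y *\<^sub>R (delta x - delta y)) z"
  proof (cases "z = x")
    case True
    have "(\<Sum>w | c x w > 0. c x w * (delta x x - delta x w)) = (\<Sum>w | c x w > 0. c x w * (delta x x - delta w x))"
      by (rule sum.cong) (auto simp: delta_eq)
    then show ?thesis
      by (simp add: True laplacian_def sum_at[OF locally_finite] scaleR_fun_def)
  next
    case False
    have "(\<Sum>w | c z w > 0. c z w * (delta x z - delta x w)) = (\<Sum>w | c z w > 0. if w = x then - c z x else 0)"
      using False by (intro sum.cong) (auto simp: delta_eq)
    also have "\<dots> = - c x z"
      using locally_finite[of z] nonneg[of z x] sym[of x z] by simp
    also have "\<dots> = (\<Sum>w | c x w > 0. if w = z then - c x z else 0)"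
      using locally_finite[of x] nonneg[of x z] by simp
    also have "\<dots> = (\<Sum>w | c x w > 0. c x w * (delta x z - delta w z))"
      using False by (intro sum.cong) (auto simp: delta_eq)
    finally show ?thesis
      by (simp add: laplacian_def sum_at[OF locally_finite] scaleR_fun_def)
  qed
qed

lemma laplacian_span_delta:
  assumes "f \<in> span (range delta)"
  shows "laplacian c f \<in> span (range delta)"
proof -
  have "span (range delta) \<subseteq> {f. laplacian c f \<in> span (range delta)}"
  proof (rule span_minimal)
    show "range delta \<subseteq> {f. laplacian c f \<in> span (range delta)}"
      by (auto simp: laplacian_delta intro!: span_sum span_scale span_diff intro: span_base[OF rangeI])
    show "subspace {f. laplacian c f \<in> span (range delta)}"
      by (auto simp: subspace_def laplacian_linear span_zero span_add span_scale)
  qed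
  then show ?thesis using assms by blast
qed

lemma laplacian_delta_L2: "laplacian c (delta x) \<in> pts L2"
  using laplacian_span_delta[of "delta x"] span_delta_L2 by (auto simp: span_base)

lemma ip_L2_laplacian_delta:
  assumes "f \<in> pts L2"
  shows "ip L2 (laplacian c (delta x)) f = laplacian c f x"
proof -
  have "ip L2 (laplacian c (delta x)) f = (\<Sum>y | c x y > 0. ip L2 (c x y *\<^sub>R (delta x - delta y)) f)"
    unfolding laplacian_delta by (rule L2.ip_sum_left) (simp_all add: delta_L2 assms del: minus_apply)
  also have "\<dots> = laplacian c f x"
    unfolding laplacian_def
    by (rule sum.cong) (use assms in \<open>simp_all add: L2.ip_linear delta_L2 ip_L2_delta\<close>)
  finally show ?thesis .
qed

lemma cls_delta_HE: "cls (delta x) \<in> pts (HE c)"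
proof -
  have "{p. grad c (cls (delta x)) p \<noteq> 0} \<subseteq> {x} \<times> {y. c x y > 0} \<union> {y. c x y > 0} \<times> {x}"
    using nonneg sym by (auto simp: grad_def diff_q_cls delta_eq less_le split: if_splits)
  then have "finite {p. grad c (cls (delta x)) p \<noteq> 0}"
    by (rule finite_subset) (simp add: locally_finite)
  then show ?thesis unfolding HE_iff by (rule finite_support_L2)
qed

lemma diff_q_swap: "diff_q u y x = - diff_q u x y"
  by (cases u rule: cls_cases) (simp add: diff_q_cls)

text \<open>
  The delta functions reproduce the Laplacian: the gradient of \<open>\<delta>\<^sub>x\<close> is supported on the ordered
  pairs \<open>(x, y)\<close> and \<open>(y, x)\<close> with \<open>y \<sim> x\<close>, and these two families contribute equally.
\<close>

lemma ip_HE_delta: "ip (HE c) (cls (delta x)) u = laplacian_q c u x"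
proof -
  let ?N = "{y. c x y > 0}"
  let ?F = "\<lambda>p. grad c (cls (delta x)) p * grad c u p"
  have root: "sqrt a * (sqrt a * t) = a * t" if "0 \<le> a" for a t :: real
    using that by (simp flip: mult.assoc)
  have F: "?F (x, y) = c x y * diff_q u x y / 2" "?F (y, x) = c x y * diff_q u x y / 2" if "y \<in> ?N" for y
    using that no_loops[of x] sym[of y x] diff_q_swap[of u y x]
    by (auto simp: grad_def diff_q_cls delta_eq root)
  have "ip (HE c) (cls (delta x)) u = (\<Sum>\<^sub>\<infinity>p\<in>Pair x ` ?N \<union> (\<lambda>y. (y, x)) ` ?N. ?F p)"
    unfolding ip_HE ip_L2
    by (rule infsum_cong_neutral)
      (use nonneg sym in \<open>auto simp: grad_def diff_q_cls delta_eq less_le image_iff split: if_splits\<close>)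
  also have "\<dots> = (\<Sum>p\<in>Pair x ` ?N \<union> (\<lambda>y. (y, x)) ` ?N. ?F p)"
    by (simp add: locally_finite)
  also have "\<dots> = (\<Sum>p\<in>Pair x ` ?N. ?F p) + (\<Sum>p\<in>(\<lambda>y. (y, x)) ` ?N. ?F p)"
    using no_loops by (intro sum.union_disjoint) (auto simp: locally_finite)
  also have "\<dots> = (\<Sum>y\<in>?N. ?F (x, y)) + (\<Sum>y\<in>?N. ?F (y, x))"
    by (subst (1 2) sum.reindex) (auto simp: inj_on_def)
  also have "\<dots> = (\<Sum>y\<in>?N. c x y * diff_q u x y / 2) + (\<Sum>y\<in>?N. c x y * diff_q u x y / 2)"
    using F by (intro arg_cong2[where f = "(+)"] sum.cong) auto
  also have "\<dots> = laplacian_q c u x"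
    by (simp add: laplacian_q_eq flip: sum.distrib)
  finally show ?thesis .
qed

lemma span_delta_HE: "f \<in> span (range delta) \<Longrightarrow> cls f \<in> pts (HE c)"
proof -
  have "span (range delta) \<subseteq> {f. cls f \<in> pts (HE c)}"
    by (rule span_minimal) (auto simp: cls_delta_HE subspace_def cls_linear)
  then show "f \<in> span (range delta) \<Longrightarrow> cls f \<in> pts (HE c)" by blast
qed

section \<open>The closed inclusion operator and its adjoint\<close>

sublocale J: hilbert_pair L2 "HE c" ..

lemma inclusion_pts: "{(f, cls f) | f. f \<in> span (range delta)} \<subseteq> pts L2 \<times> pts (HE c)"
  using span_delta_L2 span_delta_HE by auto

lemma inclusion_subspace: "subspace {(f, cls f) | f. f \<in> span (range delta)}"
  by (auto simp: subspace_def zero_prod_def cls_linear span_zero span_add span_scale)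

lemma inclusion_J_op: "f \<in> span (range delta) \<Longrightarrow> (f, cls f) \<in> J_op c"
  unfolding J_op_def using J.graph_closure_superset[OF inclusion_pts] by blast

lemma J_adj_iff:
  "(k, h) \<in> J_adj c \<longleftrightarrow> k \<in> pts (HE c) \<and> h \<in> pts L2 \<and> h = laplacian_q c k"
  unfolding J_op_def J.hadj_graph_closure[OF inclusion_pts]
proof safe
  assume kh: "(k, h) \<in> hadj L2 (HE c) {(f, cls f) | f. f \<in> span (range delta)}"
  show "k \<in> pts (HE c)" "h \<in> pts L2" using hadjD[OF kh] by auto
  show "h = laplacian_q c k"
  proof
    fix x
    have "ip (HE c) (cls (delta x)) k = ip L2 (delta x) h"
      by (rule hadjD(3)[OF kh]) (auto intro: span_base)
    then show "h x = laplacian_q c k x" by (simp add: ip_HE_delta ip_L2_delta)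
  qed
next
  assume k: "k \<in> pts (HE c)" and h: "laplacian_q c k \<in> pts L2"
  have "span (range delta) \<subseteq> {f \<in> pts L2. cls f \<in> pts (HE c) \<and>
      ip (HE c) (cls f) k = ip L2 f (laplacian_q c k)}"
  proof (rule span_minimal)
    show "subspace {f \<in> pts L2. cls f \<in> pts (HE c) \<and>
        ip (HE c) (cls f) k = ip L2 f (laplacian_q c k)}"
      using k h by (auto simp: subspace_def cls_linear HE.ip_linear L2.ip_linear)
  qed (auto simp: cls_delta_HE delta_L2 ip_HE_delta ip_L2_delta)
  then show "(k, laplacian_q c k) \<in> hadj L2 (HE c) {(f, cls f) | f. f \<in> span (range delta)}"
    using k h by (intro hadjI) auto
qed

lemma J_op_pts: "J_op c \<subseteq> pts L2 \<times> pts (HE c)"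
  unfolding J_op_def by (rule graph_closure_pts)

text \<open>With \<open>a = 0\<close> this solves \<open>(1 + J J\<^sup>*) u = b\<close>; with \<open>b = 0\<close> it solves \<open>(1 + J\<^sup>* J) f = a\<close>.\<close>

lemma J_decomposition:
  assumes "a \<in> pts L2" "b \<in> pts (HE c)"
  obtains f m where "(f, m) \<in> J_op c" "(b - m, f - a) \<in> J_adj c"
  using J.graph_decomposition[OF inclusion_subspace inclusion_pts assms] unfolding J_op_def by blast

lemma J_adj_J_surjective:
  assumes h: "h \<in> pts L2"
  obtains f k where "(f, k) \<in> J_op c" "(k, h - f) \<in> J_adj c"
proof -
  obtain f m where J: "(f, m) \<in> J_op c" "(0 - m, f - h) \<in> J_adj c"
    using J_decomposition[OF h HE.pts_closed(1)] by metis
  have V: "f \<in> pts L2" "m \<in> pts (HE c)" using J J_op_pts by auto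
  have "f - h = - laplacian_q c m" using J(2) by (simp add: J_adj_iff laplacian_q_linear)
  then have "h - f = laplacian_q c m" by (metis minus_diff_eq add.inverse_inverse)
  moreover have "h - f \<in> pts L2" by (rule L2.pts_closed(3)[OF h V(1)])
  ultimately have "(m, h - f) \<in> J_adj c" using V by (simp only: J_adj_iff simp_thms)
  then show ?thesis using that J(1) by blast
qed

section \<open>The Laplacian on square-summable functions\<close>

lemma finite_large_values:
  fixes f :: "'a \<Rightarrow> real"
  assumes f: "f \<in> pts L2" and e: "e > 0"
  shows "finite {x. e \<le> \<bar>f x\<bar>}"
proof (rule ccontr)
  assume inf: "infinite {x. e \<le> \<bar>f x\<bar>}"
  obtain n :: nat where n: "(\<Sum>\<^sub>\<infinity>x. (f x)\<^sup>2) < real n * e\<^sup>2"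
    using reals_Archimedean3[of "e\<^sup>2"] e by auto
  obtain B where B: "finite B" "card B = n" "B \<subseteq> {x. e \<le> \<bar>f x\<bar>}"
    using infinite_arbitrarily_large[OF inf] by blast
  have "e\<^sup>2 \<le> (f x)\<^sup>2" if "x \<in> B" for x
    using B(3) e that by (auto simp: abs_le_square_iff[symmetric])
  then have "real n * e\<^sup>2 \<le> (\<Sum>x\<in>B. (f x)\<^sup>2)"
    using sum_mono[of B "\<lambda>_. e\<^sup>2" "\<lambda>x. (f x)\<^sup>2"] B by simp
  also have "\<dots> \<le> (\<Sum>\<^sub>\<infinity>x. (f x)\<^sup>2)"
    using f B(1) by (intro finite_sum_le_infsum) (auto simp: L2_iff)
  finally show False using n by simp
qed

text \<open>
  Maximum principle: at a vertex where \<open>\<bar>f\<bar>\<close> is maximal, \<open>\<Delta> f\<close> has the sign of \<open>f\<close> or vanishes.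
  Such a vertex exists because a square-summable function exceeds any given positive bound in
  absolute value at only finitely many vertices.
\<close>

lemma laplacian_eq_minus_self:
  assumes f: "f \<in> pts L2" and eq: "laplacian c f = - f"
  shows "f = 0"
proof (rule ccontr)
  assume "f \<noteq> 0"
  then obtain x0 where x0: "f x0 \<noteq> 0" by (auto simp: fun_eq_iff)
  let ?A = "(\<lambda>x. \<bar>f x\<bar>) ` {x. \<bar>f x0\<bar> \<le> \<bar>f x\<bar>}"
  have A: "finite ?A" "?A \<noteq> {}" using finite_large_values[OF f] x0 by auto
  obtain x where x: "\<bar>f x0\<bar> \<le> \<bar>f x\<bar>" "Max ?A = \<bar>f x\<bar>"
    using Max_in[OF A] by auto
  have max: "\<bar>f y\<bar> \<le> \<bar>f x\<bar>" if "\<bar>f x0\<bar> \<le> \<bar>f y\<bar>" for y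
    using Max_ge[OF A(1), of "\<bar>f y\<bar>"] x(2) that by auto
  have max': "\<bar>f y\<bar> \<le> \<bar>f x\<bar>" for y using max[of y] x(1) by linarith
  have lap: "laplacian c f x = - f x" using eq by simp
  show False
  proof (cases "f x > 0")
    case True
    then have "f y \<le> f x" for y using max'[of y] by linarith
    then have "0 \<le> laplacian c f x"
      unfolding laplacian_def by (intro sum_nonneg mult_nonneg_nonneg) (auto simp: nonneg)
    then show False using lap True by simp
  next
    case False
    then have neg: "f x < 0" using x x0 by linarith
    then have "f x \<le> f y" for y using max'[of y] by linarith
    then have "laplacian c f x \<le> 0"
      unfolding laplacian_def by (intro sum_nonpos mult_nonneg_nonpos) (auto simp: nonneg)
    then show False using lap neg by simp
  qed
qed

lemma resolvent_unique:
  assumes "f \<in> pts L2" "f' \<in> pts L2" "f + laplacian c f = f' + laplacian c f'"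
  shows "f = f'"
proof -
  have "laplacian c (f - f') = - (f - f')"
    using assms(3) by (simp add: laplacian_linear algebra_simps)
  then have "f - f' = 0" using assms by (intro laplacian_eq_minus_self) auto
  then show ?thesis by simp
qed

text \<open>
  Neither this lemma nor the next needs pointwise limits: they follow by testing with
  \<open>\<delta>\<^sub>x\<close>, whose Laplacian is finitely supported.
\<close>

lemma J_adj_J_laplacian:
  assumes J: "(f, k) \<in> J_op c" and kh: "(k, h) \<in> J_adj c"
  shows "h = laplacian c f"
proof
  fix x
  have V: "f \<in> pts L2" using J J_op_pts by auto
  have "(cls (delta x), laplacian c (delta x)) \<in> J_adj c"
    by (simp add: J_adj_iff cls_delta_HE laplacian_delta_L2 laplacian_q_cls)
  from hadjD(3)[OF this J] have "ip (HE c) (cls (delta x)) k = ip L2 (laplacian c (delta x)) f"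
    by (simp add: HE.ip_commute[of k] L2.ip_commute[of f])
  then show "h x = laplacian c f x"
    using kh V by (simp add: ip_HE_delta ip_L2_laplacian_delta J_adj_iff)
qed

lemma Lap_L2_laplacian:
  assumes fh: "(f, h) \<in> Lap_L2 c"
  shows "f \<in> pts L2" "h \<in> pts L2" "h = laplacian c f"
proof -
  interpret LL: hilbert_pair "L2 :: ('v \<Rightarrow> real) hspace" "L2 :: ('v \<Rightarrow> real) hspace" ..
  show V: "f \<in> pts L2" "h \<in> pts L2" using fh by (auto simp: Lap_L2_def graph_closure_def)
  show "h = laplacian c f"
  proof
    fix x
    have "ip L2 h (delta x) = ip L2 f (laplacian c (delta x))"
    proof (rule LL.adjoint_relation_closure[OF _ delta_L2 laplacian_delta_L2 _ fh[unfolded Lap_L2_def]])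
      show "{(f, laplacian c f) | f. f \<in> span (range delta)} \<subseteq> pts L2 \<times> pts L2"
        using span_delta_L2 laplacian_span_delta by auto
      fix g g' assume "(g, g') \<in> {(f, laplacian c f) | f. f \<in> span (range delta)}"
      then have g: "g \<in> pts L2" "g' = laplacian c g" using span_delta_L2 by auto
      have "ip L2 (delta x) g' = ip L2 (laplacian c (delta x)) g"
        using g by (simp add: ip_L2_delta ip_L2_laplacian_delta)
      then show "ip L2 g' (delta x) = ip L2 g (laplacian c (delta x))"
        by (simp add: L2.ip_commute[of g] L2.ip_commute[of g'])
    qed
    then show "h x = laplacian c f x"
      using V by (simp add: L2.ip_commute[of h] L2.ip_commute[of f] ip_L2_delta ip_L2_laplacian_delta)
  qed
qed

lemma resolvent_range_dense:
  assumes g: "g \<in> pts L2" and e: "e > 0"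
  shows "\<exists>f\<in>span (range delta). hnorm L2 (g - (f + laplacian c f)) < e"
proof -
  let ?M = "(\<lambda>f. f + laplacian c f) ` span (range delta)"
  have "\<exists>m\<in>?M. hnorm L2 (g - m) < e"
  proof (rule L2.dense_if_orthogonal_trivial[OF _ _ _ g e])
    have "linear (\<lambda>f. f + laplacian c f)"
      by (rule linearI) (simp_all add: laplacian_linear algebra_simps)
    then show "subspace ?M" by (rule linear_subspace_image) (rule subspace_span)
    show "?M \<subseteq> pts L2"
      using span_delta_L2 laplacian_span_delta by (auto intro!: L2.pts_closed)
    fix y :: "'v \<Rightarrow> real"
    assume y: "y \<in> pts L2" and orth: "\<And>m. m \<in> ?M \<Longrightarrow> ip L2 y m = 0"
    show "y = 0"
    proof (rule laplacian_eq_minus_self[OF y], rule ext)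
      fix x
      have "ip L2 y (delta x + laplacian c (delta x)) = 0"
        by (rule orth) (auto intro: span_base)
      then have "ip L2 (delta x) y + ip L2 (laplacian c (delta x)) y = 0"
        using L2.ip_add_left[OF delta_L2 laplacian_delta_L2 y] by (simp add: L2.ip_commute[of y])
      then show "laplacian c y x = (- y) x"
        using y by (simp add: ip_L2_delta ip_L2_laplacian_delta)
    qed
  qed
  then show ?thesis by auto
qed

lemma J_adj_J_subset_Lap_L2: "J_op c O J_adj c \<subseteq> Lap_L2 c"
proof (rule subrelI)
  fix f h assume "(f, h) \<in> J_op c O J_adj c"
  then obtain k where fk: "(f, k) \<in> J_op c" and kh: "(k, h) \<in> J_adj c" by blast
  have V: "f \<in> pts L2" "k \<in> pts (HE c)" "h \<in> pts L2"
    using fk kh J_op_pts by (auto simp: J_adj_iff)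
  show "(f, h) \<in> Lap_L2 c"
    unfolding Lap_L2_def graph_closure_def
  proof (intro CollectI case_prodI conjI V allI impI)
    fix e :: real assume "e > 0"
    then obtain g where g: "g \<in> span (range delta)"
      and close: "hnorm L2 ((f + h) - (g + laplacian c g)) < e"
      using resolvent_range_dense[of "f + h"] V by auto
    let ?g' = "laplacian c g"
    have gV: "g \<in> pts L2" "?g' \<in> pts L2" "cls g \<in> pts (HE c)"
      using g span_delta_L2 laplacian_span_delta span_delta_HE by auto
    have gJ: "(g, cls g) \<in> J_op c" "(cls g, ?g') \<in> J_adj c"
      using g gV inclusion_J_op by (auto simp: J_adj_iff laplacian_q_cls)
    define d e' where "d = f - g" and "e' = h - ?g'"
    have dV: "d \<in> pts L2" "e' \<in> pts L2" using V gV by (auto simp: d_def e'_def)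
    \<comment> \<open>positivity of \<open>J\<^sup>* J\<close>, applied to \<open>d\<close>\<close>
    have "ip L2 d e' = ip (HE c) (k - cls g) (k - cls g)"
      using V gV hadjD(3)[OF kh fk] hadjD(3)[OF kh gJ(1)] hadjD(3)[OF gJ(2) fk] hadjD(3)[OF gJ(2) gJ(1)]
      by (simp add: d_def e'_def L2.ip_linear HE.ip_linear)
    then have pos: "0 \<le> ip L2 d e'" using V gV by (simp add: HE.ip_nonneg)
    have sum: "(f + h) - (g + ?g') = d + e'" by (simp add: d_def e'_def)
    have "ip L2 d d \<le> ip L2 (d + e') (d + e')" "ip L2 e' e' \<le> ip L2 (d + e') (d + e')"
      using dV pos L2.ip_nonneg[OF dV(1)] L2.ip_nonneg[OF dV(2)]
      by (simp_all add: L2.ip_linear L2.ip_commute[of e' d])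
    then have "hnorm L2 d < e" "hnorm L2 e' < e"
      using close unfolding sum hnorm_def by (meson le_less_trans real_sqrt_le_mono)+
    then show "\<exists>(a, b)\<in>{(f, laplacian c f) | f. f \<in> span (range delta)}.
        hnorm L2 (f - a) < e \<and> hnorm L2 (h - b) < e"
      using g by (intro bexI[of _ "(g, ?g')"]) (auto simp: d_def e'_def)
  qed
qed

lemma J_adj_J_eq_Lap_L2: "J_op c O J_adj c = Lap_L2 c"
proof (intro equalityI J_adj_J_subset_Lap_L2 subrelI)
  fix f h assume fh: "(f, h) \<in> Lap_L2 c"
  note f = Lap_L2_laplacian[OF fh]
  obtain f' k where J: "(f', k) \<in> J_op c" "(k, f + h - f') \<in> J_adj c"
    using J_adj_J_surjective[of "f + h"] f by auto
  have V: "f' \<in> pts L2" using J J_op_pts by auto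
  have "f' + laplacian c f' = f + laplacian c f"
    using f(3) by (simp flip: J_adj_J_laplacian[OF J])
  then have "f' = f" using resolvent_unique[OF V f(1)] by blast
  then show "(f, h) \<in> J_op c O J_adj c" using J by auto
qed

lemma Lap_L2_self_adjoint: "self_adjoint L2 (Lap_L2 c)"
proof (rule L2.symmetric_surjective_self_adjoint)
  interpret LL: hilbert_pair "L2 :: ('v \<Rightarrow> real) hspace" "L2 :: ('v \<Rightarrow> real) hspace" ..
  show pts: "Lap_L2 c \<subseteq> pts L2 \<times> pts L2" unfolding Lap_L2_def by (rule graph_closure_pts)
  show "densely_defined L2 (Lap_L2 c)"
    unfolding densely_defined_def
  proof (intro conjI ballI allI impI)
    show "Domain (Lap_L2 c) \<subseteq> pts L2" using pts by auto
    fix f :: "'v \<Rightarrow> real" and e :: real assume "f \<in> pts L2" "e > 0"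
    then have "\<exists>g\<in>span (range delta). hnorm L2 (f - g) < e"
    proof (intro L2.dense_if_orthogonal_trivial subspace_span span_delta_L2)
      fix y :: "'v \<Rightarrow> real"
      assume "y \<in> pts L2" and orth: "\<And>m. m \<in> span (range delta) \<Longrightarrow> ip L2 y m = 0"
      have "y x = 0" for x
        using orth[of "delta x"] by (simp add: span_base L2.ip_commute[of y] ip_L2_delta)
      then show "y = 0" by auto
    qed
    moreover have "span (range delta) \<subseteq> Domain (Lap_L2 c)"
    proof
      fix g :: "'v \<Rightarrow> real" assume g: "g \<in> span (range delta)"
      have "{(f, laplacian c f) | f. f \<in> span (range delta)} \<subseteq> pts L2 \<times> pts L2"
        using span_delta_L2 laplacian_span_delta by auto
      from LL.graph_closure_superset[OF this] show "g \<in> Domain (Lap_L2 c)"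
        using g unfolding Lap_L2_def by blast
    qed
    ultimately show "\<exists>a\<in>Domain (Lap_L2 c). hnorm L2 (f - a) < e" by blast
  qed
next
  fix x y x' y' assume "(x, y) \<in> Lap_L2 c" "(x', y') \<in> Lap_L2 c"
  then obtain k k' where k: "(x, k) \<in> J_op c" "(k, y) \<in> J_adj c" "(x', k') \<in> J_op c" "(k', y') \<in> J_adj c"
    unfolding J_adj_J_eq_Lap_L2[symmetric] by blast
  show "ip L2 y x' = ip L2 x y'"
    using hadjD(3)[OF k(2) k(3)] hadjD(3)[OF k(4) k(1)]
    by (simp add: L2.ip_commute[of y] HE.ip_commute[of k'])
next
  fix h :: "'v \<Rightarrow> real" assume h: "h \<in> pts L2"
  obtain f k where "(f, k) \<in> J_op c" "(k, h - f) \<in> J_adj c"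
    using J_adj_J_surjective[OF h] .
  then show "\<exists>k m. (k, m) \<in> Lap_L2 c \<and> k + m = h"
    unfolding J_adj_J_eq_Lap_L2[symmetric] by (intro exI[of _ f] exI[of _ "h - f"]) auto
qed

section \<open>The Laplacian on the energy space\<close>

lemma dipole_reproducing:
  "dipole c r x \<in> pts (HE c)"
  "u \<in> pts (HE c) \<Longrightarrow> ip (HE c) (dipole c r x) u = diff_q u x r"
proof -
  obtain C where C: "\<forall>u\<in>pts (HE c). \<bar>diff_q u x r\<bar> \<le> C * hnorm (HE c) u"
    using diff_q_bounded by blast
  have "\<exists>!v. v \<in> pts (HE c) \<and> (\<forall>u\<in>pts (HE c). ip (HE c) v u = diff_q u x r)"
    by (rule HE.Riesz_representation[of _ C]) (use C in \<open>simp_all add: diff_q_linear\<close>)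
  from theI'[OF this] show "dipole c r x \<in> pts (HE c)"
    "u \<in> pts (HE c) \<Longrightarrow> ip (HE c) (dipole c r x) u = diff_q u x r"
    unfolding dipole_def by auto
qed

lemma laplacian_dipole: "laplacian_q c (dipole c r x) = delta x - delta r"
proof
  fix y
  have "laplacian_q c (dipole c r x) y = ip (HE c) (dipole c r x) (cls (delta y))"
    by (simp add: HE.ip_commute[of "dipole c r x"] ip_HE_delta)
  then show "laplacian_q c (dipole c r x) y = (delta x - delta r) y"
    by (simp add: dipole_reproducing cls_delta_HE diff_q_cls delta_eq)
qed

text \<open>
  The energy-minimising monopole exists as soon as some monopole does: it is the residual of any
  monopole after projection onto the harmonic functions, which form a closed subspace.
\<close>

lemma monopole_min_monopole:
  assumes "monopole c r w0"
  shows "monopole c r (min_monopole c r)"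
proof -
  define M where "M = {u \<in> pts (HE c). laplacian_q c u = 0}"
  have w0: "w0 \<in> pts (HE c)" "laplacian_q c w0 = delta r" using assms by (auto simp: monopole_def)
  have subspace_M: "subspace M" "M \<subseteq> pts (HE c)"
    by (auto simp: M_def subspace_def laplacian_q_linear)
  obtain p where p: "p \<in> pts (HE c)" "\<And>e. e > 0 \<Longrightarrow> \<exists>m\<in>M. hnorm (HE c) (p - m) < e"
    "\<And>y. y \<in> M \<Longrightarrow> ip (HE c) (w0 - p) y = 0"
    using HE.projection[OF subspace_M w0(1)] by metis
  have "laplacian_q c p x = 0" for x
  proof (rule ccontr)
    let ?C = "hnorm (HE c) (cls (delta x))"
    assume "laplacian_q c p x \<noteq> 0"
    then obtain m where m: "m \<in> M" "hnorm (HE c) (p - m) < \<bar>laplacian_q c p x\<bar> / (?C + 1)"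
      using p(2)[of "\<bar>laplacian_q c p x\<bar> / (?C + 1)"] HE.hnorm_nonneg[OF cls_delta_HE[of x]]
      by (auto simp: divide_simps)
    have "\<bar>laplacian_q c p x\<bar> = \<bar>ip (HE c) (cls (delta x)) (p - m)\<bar>"
      using m(1) by (simp add: M_def ip_HE_delta laplacian_q_linear)
    also have "\<dots> \<le> ?C * hnorm (HE c) (p - m)"
      using p(1) m(1) by (intro HE.Cauchy_Schwarz) (auto simp: M_def cls_delta_HE)
    also have "\<dots> \<le> (?C + 1) * hnorm (HE c) (p - m)"
      using p(1) m(1) by (intro mult_right_mono) (auto simp: M_def)
    also have "\<dots> < \<bar>laplacian_q c p x\<bar>"
      using m(2) HE.hnorm_nonneg[OF cls_delta_HE[of x]] by (simp add: field_simps)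
    finally show False by simp
  qed
  then have p0: "laplacian_q c p = 0" by auto
  define w where "w = w0 - p"
  have w: "w \<in> pts (HE c)" "laplacian_q c w = delta r"
    using w0 p(1) p0 by (auto simp: w_def laplacian_q_linear)
  have Pythagoras: "ip (HE c) w' w' = ip (HE c) w w + ip (HE c) (w' - w) (w' - w)"
    and w'_pts: "w' \<in> pts (HE c)" if "monopole c r w'" for w'
  proof -
    show V: "w' \<in> pts (HE c)" using that by (simp add: monopole_def)
    have "w' - w \<in> M" using that w by (simp add: M_def monopole_def laplacian_q_linear)
    then have "ip (HE c) w (w' - w) = 0" using p(3) w_def by blast
    then show "ip (HE c) w' w' = ip (HE c) w w + ip (HE c) (w' - w) (w' - w)"
      using V w by (simp add: HE.ip_linear HE.ip_commute[of w' w])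
  qed
  have mono: "monopole c r w" using w by (simp add: monopole_def)
  have "min_monopole c r = w"
    unfolding min_monopole_def
  proof (rule the_equality)
    show "monopole c r w \<and> (\<forall>w'. monopole c r w' \<longrightarrow> ip (HE c) w w \<le> ip (HE c) w' w')"
    proof (intro conjI allI impI mono)
      fix w' assume w': "monopole c r w'"
      have "0 \<le> ip (HE c) (w' - w) (w' - w)" using w'_pts[OF w'] w by (simp add: HE.ip_nonneg)
      then show "ip (HE c) w w \<le> ip (HE c) w' w'" using Pythagoras[OF w'] by linarith
    qed
    fix v assume v: "monopole c r v \<and> (\<forall>w'. monopole c r w' \<longrightarrow> ip (HE c) v v \<le> ip (HE c) w' w')"
    then have "ip (HE c) v v \<le> ip (HE c) w w" "ip (HE c) v v = ip (HE c) w w + ip (HE c) (v - w) (v - w)"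
      using mono Pythagoras[of v] by blast+
    then have "ip (HE c) (v - w) (v - w) \<le> 0" by linarith
    moreover have "v - w \<in> pts (HE c)" using v w w'_pts[of v] by simp
    ultimately have "v - w = 0"
      using HE.ip_nonneg[of "v - w"] by (intro HE.ip_definite) (auto intro: antisym)
    then show "v = w" by simp
  qed
  then show ?thesis using mono by simp
qed

lemma J_J_adj_symmetric_nonneg:
  assumes "(x, y) \<in> J_adj c O J_op c"
  shows "x \<in> pts (HE c)" "y \<in> pts (HE c)" "0 \<le> ip (HE c) x y"
    "(x', y') \<in> J_adj c O J_op c \<Longrightarrow> ip (HE c) y x' = ip (HE c) x y'"
proof -
  obtain f where f: "(x, f) \<in> J_adj c" "(f, y) \<in> J_op c" using assms by blast
  show "x \<in> pts (HE c)" "y \<in> pts (HE c)" using f J_op_pts by (auto simp: J_adj_iff)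
  have "f \<in> pts L2" using f(1) unfolding J_adj_iff by blast
  then show "0 \<le> ip (HE c) x y"
    using hadjD(3)[OF f] by (simp add: HE.ip_commute[of x] L2.ip_nonneg)
  assume "(x', y') \<in> J_adj c O J_op c"
  then obtain f' where f': "(x', f') \<in> J_adj c" "(f', y') \<in> J_op c" by blast
  show "ip (HE c) y x' = ip (HE c) x y'"
    using hadjD(3)[OF f'(1) f(2)] hadjD(3)[OF f(1) f'(2)]
    by (simp add: HE.ip_commute[of x] L2.ip_commute[of f'])
qed

lemma laplacian_wfun:
  assumes "monopole c r w"
  shows "wfun c r x \<in> pts (HE c)" "laplacian_q c (wfun c r x) = delta x"
  using monopole_min_monopole[OF assms]
  by (auto simp: wfun_def monopole_def dipole_reproducing laplacian_q_linear laplacian_dipole)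

lemma span_wfun:
  assumes w: "monopole c r w" and u: "u \<in> span (range (wfun c r))"
  shows "u \<in> pts (HE c)" "laplacian_q c u \<in> span (range delta)"
proof -
  have "span (range (wfun c r)) \<subseteq> {u \<in> pts (HE c). laplacian_q c u \<in> span (range delta)}"
    by (rule span_minimal)
      (auto simp: laplacian_wfun[OF w] span_base subspace_def laplacian_q_linear span_zero span_add span_scale)
  then show "u \<in> pts (HE c)" "laplacian_q c u \<in> span (range delta)" using u by auto
qed

lemma span_wfun_dense:
  assumes w: "monopole c r w" and u: "u \<in> pts (HE c)" and e: "e > 0"
  shows "\<exists>a\<in>span (range (wfun c r)). hnorm (HE c) (u - a) < e"
proof (rule HE.dense_if_orthogonal_trivial[OF subspace_span _ _ u e])
  show "span (range (wfun c r)) \<subseteq> pts (HE c)" using span_wfun(1)[OF w] by blast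
  fix y assume y: "y \<in> pts (HE c)"
    and orth: "\<And>m. m \<in> span (range (wfun c r)) \<Longrightarrow> ip (HE c) y m = 0"
  show "y = 0"
  proof (rule diff_q_eq_0D)
    fix x
    have wfun0: "ip (HE c) (wfun c r x) y = 0" for x
      using orth[of "wfun c r x"] by (simp add: span_base HE.ip_commute[of y])
    show "diff_q y x r = 0"
    proof (cases "x = r")
      case True
      then show ?thesis using diff_q_swap[of y r r] by simp
    next
      case False
      have "wfun c r x = wfun c r r + dipole c r x" using False by (simp add: wfun_def)
      then show ?thesis
        using wfun0[of x] wfun0[of r] y laplacian_wfun(1)[OF w, of r]
        by (simp add: HE.ip_linear dipole_reproducing)
    qed
  qed
qed

lemma krein_extension_J_J_adj:
  assumes w: "monopole c r w"
  shows "krein_extension (HE c) (Lap_HE c r) (J_adj c O J_op c)"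
proof -
  interpret EE: hilbert_pair "HE c" "HE c" ..
  let ?W = "span (range (wfun c r))"
  let ?S0 = "{(u, cls (laplacian_q c u)) | u. u \<in> ?W}"
  let ?T = "J_adj c O J_op c"
  have S0_pts: "?S0 \<subseteq> pts (HE c) \<times> pts (HE c)"
    using span_wfun[OF w] span_delta_HE by auto
  have T_pts: "?T \<subseteq> pts (HE c) \<times> pts (HE c)"
  proof (rule subrelI)
    fix x y assume "(x, y) \<in> ?T"
    then show "(x, y) \<in> pts (HE c) \<times> pts (HE c)" using J_J_adj_symmetric_nonneg(1,2) by blast
  qed
  have S0_T: "?S0 \<subseteq> ?T"
  proof clarify
    fix u assume u: "u \<in> ?W"
    have "(u, laplacian_q c u) \<in> J_adj c"
      using span_wfun[OF w u] span_delta_L2 by (auto simp: J_adj_iff)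
    then show "(u, cls (laplacian_q c u)) \<in> ?T"
      using inclusion_J_op[OF span_wfun(2)[OF w u]] by blast
  qed
  have dense: "densely_defined (HE c) A" if "A \<subseteq> pts (HE c) \<times> pts (HE c)" "?S0 \<subseteq> A" for A
    unfolding densely_defined_def
  proof (intro conjI ballI allI impI)
    show "Domain A \<subseteq> pts (HE c)" using that(1) by auto
    fix u and e :: real assume "u \<in> pts (HE c)" "e > 0"
    then obtain a where "a \<in> ?W" "hnorm (HE c) (u - a) < e" using span_wfun_dense[OF w] by blast
    then show "\<exists>a\<in>Domain A. hnorm (HE c) (u - a) < e" using that(2) by blast
  qed
  have T_sa: "self_adjoint (HE c) ?T"
  proof (rule HE.symmetric_surjective_self_adjoint[OF T_pts dense[OF T_pts S0_T]])
    show "ip (HE c) y x' = ip (HE c) x y'" if "(x, y) \<in> ?T" "(x', y') \<in> ?T" for x y x' y'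
      using J_J_adj_symmetric_nonneg(4) that by blast
    fix h assume h: "h \<in> pts (HE c)"
    obtain f m where "(f, m) \<in> J_op c" "(h - m, f - 0) \<in> J_adj c"
      using J_decomposition[of 0 h] h by auto
    then show "\<exists>k m. (k, m) \<in> ?T \<and> k + m = h"
      by (intro exI[of _ "h - m"] exI[of _ m]) auto
  qed
  have S_T: "Lap_HE c r \<subseteq> ?T"
  proof -
    have "Lap_HE c r \<subseteq> graph_closure (HE c) (HE c) ?T"
      unfolding Lap_HE_def using S0_T by (fastforce simp: graph_closure_def)
    also have "\<dots> \<subseteq> ?T"
      using HE.graph_closure_hadj[OF T_pts] T_sa by (simp add: self_adjoint_def)
    finally show ?thesis .
  qed
  have S0_S: "?S0 \<subseteq> Lap_HE c r"
    unfolding Lap_HE_def by (rule EE.graph_closure_superset[OF S0_pts])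
  have semi: "semibounded (HE c) (Lap_HE c r)"
    unfolding semibounded_def
  proof (intro conjI)
    show "densely_defined (HE c) (Lap_HE c r)" using S_T T_pts S0_S by (intro dense) auto
    show "\<forall>(x, y)\<in>Lap_HE c r. \<forall>(x', y')\<in>Lap_HE c r. ip (HE c) y x' = ip (HE c) x y'"
      using S_T J_J_adj_symmetric_nonneg(4) by blast
    show "\<exists>m. \<forall>(x, y)\<in>Lap_HE c r. m * ip (HE c) x x \<le> ip (HE c) x y"
      using S_T J_J_adj_symmetric_nonneg(3) by (intro exI[of _ 0]) auto
  qed
  have kernel: "(k, 0) \<in> ?T" if k: "(k, 0) \<in> hadj (HE c) (HE c) (Lap_HE c r)" for k
  proof -
    have kV: "k \<in> pts (HE c)" using hadjD(1)[OF k] .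
    have "laplacian_q c k = 0"
    proof
      fix x
      have "(wfun c r x, cls (delta x)) \<in> Lap_HE c r"
        using S0_S laplacian_wfun(2)[OF w, of x] span_base[of "wfun c r x" "range (wfun c r)"] by force
      from hadjD(3)[OF k this] show "laplacian_q c k x = 0 x"
        using laplacian_wfun(1)[OF w, of x] by (simp add: ip_HE_delta HE.ip_linear)
    qed
    then have "(k, 0) \<in> J_adj c" using kV by (simp add: J_adj_iff)
    moreover have "(0, 0) \<in> J_op c" using inclusion_J_op[OF span_zero] by (simp add: cls_linear)
    ultimately show ?thesis by blast
  qed
  show ?thesis
    unfolding krein_extension_def op_kernel_def using semi T_sa S_T kernel by blast
qed

end

theorem theorem3p16:
  fixes c :: "'v \<Rightarrow> 'v \<Rightarrow> real" and r :: 'v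
  assumes "network c"
  shows "(J_op c O J_adj c = Lap_L2 c \<and> self_adjoint L2 (Lap_L2 c)) \<and>
    ((\<exists>w. monopole c r w) \<longrightarrow> krein_extension (HE c) (Lap_HE c r) (J_adj c O J_op c))"
proof -
  interpret network c by fact
  show ?thesis
    using J_adj_J_eq_Lap_L2 Lap_L2_self_adjoint krein_extension_J_J_adj by blast
qed

end
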